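(* Let $p\geq 2$ and let $Y=\theta+\xi$, where $\theta\in\mathbb{R}^p$ is a constant (unknown) vector and $\xi$ is a random vector which, conditionally on a fixed $\sigma$-algebra $\mathcal{G}$, is Gaussian: $\mathrm{Law}(\xi\mid\mathcal{G})=\mathcal{N}_p(0,\mathcal{D}(\mathcal{G}))$, with $\mathcal{D}(\mathcal{G})$ a $\mathcal{G}$-measurable random positive definite $p\times p$ covariance matrix. Let $\Theta\subset\mathbb{R}^p$ be a compact set and assume: (i) there is a constant $\lambda_*>0$ such that $\lambda_{\min}(\mathcal{D}(\mathcal{G}))\geq\lambda_*$ almost surely; (ii) $\sup_{\theta\in\Theta}\mathbf{E}_\theta\,\lambda_{\max}(\mathcal{D}(\mathcal{G}))\leq a^*$ for some known constant $a^*>0$. Let $\gamma_p$ be the constant defined in the context, and consider the estimator $\theta^*=\left(1-\frac{c}{\|Y\|}\right)Y$ with $c=(p-1)\lambda_*\gamma_p$. Then $\theta^*$ dominates the maximum likelihood estimator $\hat\theta_{ML}=Y$ on $\Theta$, namely $$\sup_{\theta\in\Theta}\Delta(\theta)\leq-\big[(p-1)\lambda_*\gamma_p\big]^2,\qquad \Delta(\theta):=\mathbf{E}_\theta\|\theta^*-\theta\|^2-\mathbf{E}_\theta\|\hat\theta_{ML}-\theta\|^2 .$$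
   Context: $\mathbf{E}_\theta$ denotes expectation when the true parameter is $\theta$; $\lambda_{\min}(A),\lambda_{\max}(A)$ are the smallest and largest eigenvalues of a symmetric matrix $A$. Set $d=\sup\{\|\theta\|:\theta\in\Theta\}$ (the definition below requires $d>0$), $\mu=d/\sqrt{a^*}$, $I(a)=\int_0^\infty\frac{e^{-r^2/2}}{a+r}\,dr$, and $$\gamma_p=\frac{\sum_{j=0}^{p-2}2^{\frac{j-1}{2}}(-1)^{p-j}\mu^{p-1-j}\Gamma\!\left(\frac{j+1}{2}\right)-(-\mu)^pI(\mu)}{2^{p/2-1}\Gamma\!\left(\frac p2\right)d}.$$ *)

theory Defs
  imports "HOL-Probability.Probability"
begin

definition pos_def_mat :: "real^'n^'n \<Rightarrow> bool" where
  "pos_def_mat S \<longleftrightarrow> transpose S = S \<and> (\<forall>x. x \<noteq> 0 \<longrightarrow> x \<bullet> (S *v x) > 0)"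

definition real_eigenvalues :: "real^'n^'n \<Rightarrow> real set" where
  "real_eigenvalues S = {c. \<exists>v. v \<noteq> 0 \<and> S *v v = c *\<^sub>R v}"

definition lambda_min :: "real^'n^'n \<Rightarrow> real" where
  "lambda_min S = Min (real_eigenvalues S)"

definition lambda_max :: "real^'n^'n \<Rightarrow> real" where
  "lambda_max S = Max (real_eigenvalues S)"

definition mvn_density :: "real^'n^'n \<Rightarrow> real^'n \<Rightarrow> real" where
  "mvn_density S x =
     exp (- (x \<bullet> (matrix_inv S *v x)) / 2) / sqrt ((2 * pi) ^ CARD('n) * det S)"

definition normal_vec :: "real^'n^'n \<Rightarrow> (real^'n) measure" where
  "normal_vec S = density lborel (\<lambda>x. ennreal (mvn_density S x))"

definition I_fun :: "real \<Rightarrow> real" where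
  "I_fun a = integral {0..} (\<lambda>r. exp (- (r\<^sup>2) / 2) / (a + r))"

text \<open>The constant gamma_p, with d = sup of norms over Theta and mu = d / sqrt a*.\<close>
definition gamma_const :: "nat \<Rightarrow> real \<Rightarrow> real \<Rightarrow> real" where
  "gamma_const p d astar =
     (let \<mu> = d / sqrt astar in
      ((\<Sum>j = 0..p - 2. 2 powr ((real j - 1) / 2) * (-1) ^ (p - j) * \<mu> ^ (p - 1 - j)
                          * Gamma ((real j + 1) / 2))
        - (- \<mu>) ^ p * I_fun \<mu>)
      / (2 powr (real p / 2 - 1) * Gamma (real p / 2) * d))"

end

theory Submission
  imports Defs
begin

text \<open>
  Put \<open>h x = (x \<bullet> (\<theta> + x)) / norm (\<theta> + x)\<close>. Expanding the square, the risk difference is at most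
  \<open>c\<^sup>2 - 2 * c * E (h \<xi>)\<close>, so it suffices that \<open>E (h \<xi>) \<ge> c\<close>. Conditionally on the covariance \<open>S\<close>,
  Stein's identity for \<open>y / norm y\<close> (smoothed near \<open>0\<close>) gives
  \<open>E (h \<xi>) \<ge> (p - 1) * lam * E (1 / norm (\<theta> + \<xi>)) \<ge> (p - 1) * lam * E (1 / (d + norm \<xi>))\<close>, because
  \<open>trace S - u \<bullet> (S *v u) \<ge> (p - 1) * lam\<close> for unit vectors \<open>u\<close>. Writing \<open>\<xi> = A \<eta>\<close> with \<open>\<eta>\<close> standard normal and
  \<open>A\<close> a square root of \<open>S\<close>, one has \<open>norm \<xi> \<le> sqrt (lambda_max S) * norm \<eta>\<close>; as
  \<open>L \<mapsto> 1 / (d + sqrt L * r)\<close> is convex and decreasing, Jensen's inequality, in the form of the tangent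
  line at \<open>astar\<close>, allows \<open>lambda_max S\<close> to be replaced by \<open>astar\<close>. In polar coordinates the resulting
  radial integral \<open>E (1 / (d + sqrt astar * norm \<eta>))\<close> is exactly the constant \<open>gamma_const\<close>.
\<close>

subsection \<open>Spectral theory of symmetric matrices\<close>

text \<open>The Jacobian of \<open>y / norm y\<close> is the projection orthogonal to
  \<open>u = y / norm y\<close>, divided by \<open>norm y\<close>; contracted with \<open>S\<close>
  it gives \<open>(trace S - u \<bullet> (S *v u)) / norm y\<close>. The direction \<open>u\<close>
  costs one eigenvalue, hence \<open>p - 1\<close>. Replacing the remaining eigenvalues by
  \<open>lam\<close> takes them out of the expectation, so that \<open>S\<close> survives only in
  \<open>norm \<xi>\<close>, thus through \<open>lambda_max S\<close>, whose mean is controlled. The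
  number \<open>c\<close> is the lower bound for \<open>E (h \<xi>)\<close> itself: if that mean is
  at least \<open>b \<ge> 0\<close>, then \<open>c\<^sup>2 - 2 * c * b\<close> is least at
  \<open>c = b\<close>, with value \<open>- b\<^sup>2\<close>. The alternating sum in
  \<open>gamma_const\<close> comes from polynomial division of \<open>r ^ (p - 1)\<close> by
  \<open>\<mu> + r\<close>. Two obstacles shape the proof. The field \<open>y / norm y\<close> is
  not differentiable at \<open>0\<close>, which forces the smoothing and a passage to the limit.
  Averaging over the random covariance needs measurability in \<open>S\<close> of densities and
  eigenvalues, and the Fubini argument is run for nonnegative integrands, whereas \<open>h\<close>
  has no sign; so \<open>norm x\<close> is added to it.\<close>

declare transpose_matrix_vector [simp del]

text \<open>Induction on the dimension. A minimiser \<open>u\<close> of the Rayleigh quotient on the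
  unit sphere of \<open>V\<close> is an eigenvector, and by self-adjointness its orthogonal
  complement in \<open>V\<close> is invariant again; this is why the statement speaks of invariant
  subspaces and not only of the whole space.\<close>

lemma selfadjoint_orthonormal_eigenbasis:
  fixes f :: "'a::euclidean_space \<Rightarrow> 'a"
  assumes "linear f" and sa: "\<And>x y. f x \<bullet> y = x \<bullet> f y"
    and "subspace V" "f ` V \<subseteq> V"
  shows "\<exists>B. B \<subseteq> V \<and> pairwise orthogonal B \<and> (\<forall>b\<in>B. norm b = 1 \<and> (\<exists>c. f b = c *\<^sub>R b)) \<and> span B = V"
  using assms(3,4)
proof (induction "dim V" arbitrary: V rule: less_induct)
  case less
  note V = less.prems
  show ?case
  proof (cases "V = {0}")
    case True
    then show ?thesis by (intro exI[of _ "{}"]) auto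
  next
    case False
    have "0 \<in> V" using V(1) by (rule subspace_0)
    with False obtain v where v: "v \<in> V" "v \<noteq> 0" by blast
    let ?K = "V \<inter> sphere 0 1"
    have "compact ?K" by (simp add: V(1) closed_subspace closed_Int_compact)
    moreover have "v /\<^sub>R norm v \<in> ?K" using v V(1) by (simp add: subspace_scale)
    moreover have "continuous_on ?K (\<lambda>x. x \<bullet> f x)"
      using assms(1) by (intro continuous_intros linear_continuous_on linear_conv_bounded_linear[THEN iffD1])
    ultimately obtain u where u: "u \<in> ?K" and min: "\<And>x. x \<in> ?K \<Longrightarrow> u \<bullet> f u \<le> x \<bullet> f x"
      using continuous_attains_inf[of ?K "\<lambda>x. x \<bullet> f x"] by blast
    define m where "m = u \<bullet> f u"
    have uV: "u \<in> V" and nu: "norm u = 1" and uu: "u \<bullet> u = 1"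
      using u by (auto simp: dot_square_norm)
    have ge: "x \<bullet> f x - m * (x \<bullet> x) \<ge> 0" if "x \<in> V" for x
    proof (cases "x = 0")
      case True then show ?thesis by (simp add: linear_0[OF assms(1)])
    next
      case False
      have "x /\<^sub>R norm x \<in> ?K" using that False V(1) by (simp add: subspace_scale)
      from min[OF this] have "m \<le> (x \<bullet> f x) / (norm x * norm x)"
        by (simp add: m_def linear_scale[OF assms(1)] field_simps)
      then show ?thesis using False by (simp add: field_simps dot_square_norm power2_eq_square)
    qed
    \<comment> \<open>The residual of the eigenvalue equation; it is orthogonal to \<open>u\<close>.
      Moving \<open>u\<close> along it changes the nonnegative form in \<open>ge\<close>, which is 0
      at \<open>u\<close>, by \<open>2 * t * (w \<bullet> w)\<close> to first order. This is
      negative for small \<open>t < 0\<close> unless \<open>w = 0\<close>.\<close>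
    define w where "w = f u - m *\<^sub>R u"
    have wV: "w \<in> V" unfolding w_def using V uV by (auto intro!: subspace_diff subspace_scale)
    define g where "g = w \<bullet> f w - m * (w \<bullet> w)"
    have quad: "2 * t * (w \<bullet> w) + t\<^sup>2 * g \<ge> 0" for t
    proof -
      have "u + t *\<^sub>R w \<in> V" using V uV wV by (intro subspace_add subspace_scale)
      from ge[OF this] have "0 \<le> (u + t *\<^sub>R w) \<bullet> f (u + t *\<^sub>R w) - m * ((u + t *\<^sub>R w) \<bullet> (u + t *\<^sub>R w))" .
      also have "\<dots> = u \<bullet> f u - m + 2 * t * (w \<bullet> f u - m * (w \<bullet> u)) + t\<^sup>2 * g"
        by (simp add: linear_add[OF assms(1)] linear_scale[OF assms(1)] inner_add inner_commute[of u w] uu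
            g_def algebra_simps power2_eq_square sa[symmetric] inner_commute[of "f u" w])
      also have "\<dots> = 2 * t * (w \<bullet> w) + t\<^sup>2 * g"
        by (simp add: m_def[symmetric] w_def inner_diff inner_commute algebra_simps uu)
      finally show ?thesis .
    qed
    have "w = 0"
    proof (rule ccontr)
      assume "w \<noteq> 0"
      then have pos: "w \<bullet> w > 0" by simp
      have "g \<ge> 0" using ge[OF wV] by (simp add: g_def)
      \<comment> \<open>For \<open>g > 0\<close> the quadratic is least at
        \<open>- (w \<bullet> w) / g\<close>; adding 1 keeps the denominator positive when
        \<open>g = 0\<close>.\<close>
      define t where "t = - (w \<bullet> w) / (g + 1)"
      have tk: "t * (g + 1) = - (w \<bullet> w)" using \<open>g \<ge> 0\<close> by (simp add: t_def)
      have "t < 0" using pos \<open>g \<ge> 0\<close> by (simp add: t_def field_simps)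
      have "2 * t * (w \<bullet> w) + t\<^sup>2 * g = t * (w \<bullet> w) - t\<^sup>2 + t * (t * (g + 1) + (w \<bullet> w))"
        by (simp add: power2_eq_square algebra_simps)
      also have "\<dots> < 0" using pos \<open>t < 0\<close> mult_neg_pos[of t "w \<bullet> w"] by (simp add: tk del: zero_less_power2 inner_gt_zero_iff) (smt (verit) zero_le_power2)
      finally show False using quad[of t] by simp
    qed
    then have eig: "f u = m *\<^sub>R u" by (simp add: w_def)
    define W where "W = {x \<in> V. u \<bullet> x = 0}"
    have "subspace W" using V(1) unfolding W_def subspace_def by (auto simp: inner_add_right)
    moreover have "f ` W \<subseteq> W" using V(2) by (auto simp: W_def sa[symmetric] eig)
    moreover have "dim W < dim V"
    proof (rule dim_psubset)
      have "u \<notin> W" using uu by (simp add: W_def)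
      moreover have "W \<subseteq> V" by (auto simp: W_def)
      ultimately have "W \<subset> V" using uV by blast
      then show "span W \<subset> span V" by (simp add: span_eq_iff[THEN iffD2] V(1) \<open>subspace W\<close>)
    qed
    ultimately obtain B where B: "B \<subseteq> W" "pairwise orthogonal B"
      "\<forall>b\<in>B. norm b = 1 \<and> (\<exists>c. f b = c *\<^sub>R b)" "span B = W"
      using less.hyps by blast
    have "span (insert u B) = V"
    proof
      show "span (insert u B) \<subseteq> V" using B(1) uV V(1) by (intro span_minimal) (auto simp: W_def)
      show "V \<subseteq> span (insert u B)"
      proof
        fix x assume "x \<in> V"
        then have "x - (u \<bullet> x) *\<^sub>R u \<in> W"
          using V(1) uV uu by (auto simp: W_def inner_diff_right intro!: subspace_diff subspace_scale)
        then show "x \<in> span (insert u B)" using B(4) by (auto simp: span_insert)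
      qed
    qed
    moreover have "pairwise orthogonal (insert u B)"
      using B(1,2) by (auto simp: pairwise_insert orthogonal_def W_def inner_commute)
    ultimately show ?thesis
      using B uV nu eig by (intro exI[of _ "insert u B"]) (auto simp: W_def)
  qed
qed

definition diag_mat :: "('n \<Rightarrow> real) \<Rightarrow> real^'n^'n" where
  "diag_mat l = (\<chi> i j. if i = j then l i else 0)"

lemma diag_mat_mult_vec: "diag_mat l *v x = (\<chi> i. l i * x $ i)"
  by (simp add: diag_mat_def matrix_vector_mult_def vec_eq_iff if_distrib[of "\<lambda>a. a * _"] cong: if_cong)

lemma diag_mat_mult_diag_mat: "diag_mat l ** diag_mat k = diag_mat (\<lambda>i. l i * k i)"
  by (simp add: matrix_eq matrix_vector_mul_assoc[symmetric] diag_mat_mult_vec vec_eq_iff mult.assoc)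

lemma det_diag_mat: "det (diag_mat l) = (\<Prod>i\<in>UNIV. l i)"
  by (subst det_diagonal) (simp_all add: diag_mat_def)

text \<open>The orthonormal eigenbasis has exactly \<open>CARD('n)\<close> elements, so it can be
  enumerated by the index type and its members used as the columns of \<open>Q\<close>.\<close>

lemma symmetric_matrix_spectral:
  fixes S :: "real^'n^'n"
  assumes "transpose S = S"
  obtains Q l where "orthogonal_matrix Q" "S = Q ** diag_mat l ** transpose Q"
proof -
  have "(S *v x) \<bullet> y = x \<bullet> (S *v y)" for x y
    by (metis assms dot_lmul_matrix vector_transpose_matrix)
  then obtain B where B: "pairwise orthogonal B" "\<forall>b\<in>B. norm b = 1 \<and> (\<exists>c. S *v b = c *\<^sub>R b)"
    "span B = (UNIV :: (real^'n) set)"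
    using selfadjoint_orthonormal_eigenbasis[of "(*v) S" UNIV] by auto
  have ind: "independent B" using B(1,2) by (intro pairwise_orthogonal_independent) auto
  have "card B = CARD('n)"
    using dim_eq_card_independent[OF ind] dim_span[of B] B(3) by simp
  then obtain q where q: "bij_betw q (UNIV :: 'n set) B"
    using ind by (metis finite_class.finite_UNIV finite_same_card_bij finiteI_independent)
  have "\<forall>i. \<exists>c. S *v q i = c *\<^sub>R q i" using B(2) bij_betwE[OF q] by blast
  then obtain l where l: "\<And>i. S *v q i = l i *\<^sub>R q i" by metis
  define Q :: "real^'n^'n" where "Q = (\<chi> i j. q j $ i)"
  have col: "column i Q = q i" for i by (simp add: Q_def column_def)
  have "norm (q i) = 1" for i using bij_betwE[OF q] B(2) by blast
  moreover have "i \<noteq> j \<Longrightarrow> orthogonal (q i) (q j)" for i j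
    using B(1) q by (auto simp: pairwise_def bij_betw_def inj_on_def)
  ultimately have oQ: "orthogonal_matrix Q"
    by (simp add: orthogonal_matrix_orthonormal_columns col)
  have "(S ** Q) $ i $ j = (Q ** diag_mat l) $ i $ j" for i j
  proof -
    have "(S ** Q) $ i $ j = (S *v q j) $ i"
      by (simp add: Q_def matrix_matrix_mult_def matrix_vector_mult_def)
    also have "\<dots> = q j $ i * l j" by (simp add: l)
    also have "\<dots> = (Q ** diag_mat l) $ i $ j"
      by (simp add: Q_def diag_mat_def matrix_matrix_mult_def if_distrib[of "\<lambda>a. _ * a"] cong: if_cong)
    finally show ?thesis .
  qed
  then have "S ** Q = Q ** diag_mat l" by (simp add: vec_eq_iff)
  then have "S = Q ** diag_mat l ** transpose Q"
    using oQ by (metis matrix_mul_assoc matrix_mul_rid orthogonal_matrix_def)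
  with oQ show ?thesis by (rule that)
qed

lemma orthogonal_matrix_mult_transpose:
  fixes Q :: "real^'n^'n"
  assumes "orthogonal_matrix Q"
  shows "Q *v (transpose Q *v x) = x" "transpose Q *v (Q *v x) = x"
  using assms by (simp_all add: orthogonal_matrix_def matrix_vector_mul_assoc)

lemma norm_orthogonal_matrix_mult:
  fixes Q :: "real^'n^'n"
  assumes "orthogonal_matrix Q"
  shows "norm (Q *v x) = norm x"
  using assms orthogonal_transformation_norm[of "(*v) Q"] by (simp add: orthogonal_transformation_matrix)

context
  fixes Q S :: "real^'n^'n" and l :: "'n \<Rightarrow> real"
  assumes Q: "orthogonal_matrix Q" and S: "S = Q ** diag_mat l ** transpose Q"
begin

lemma spectral_mult_vec: "S *v x = Q *v (diag_mat l *v (transpose Q *v x))"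
  by (simp add: S matrix_vector_mul_assoc matrix_mul_assoc)

text \<open>This makes the eigenvalue set finite and nonempty, so that the \<open>Min\<close> and
  \<open>Max\<close> behind \<open>lambda_min\<close> and \<open>lambda_max\<close> are attained and
  not unspecified values.\<close>

lemma real_eigenvalues_spectral: "real_eigenvalues S = range l"
proof (intro equalityI subsetI)
  fix c assume "c \<in> real_eigenvalues S"
  then obtain v where v: "v \<noteq> 0" "S *v v = c *\<^sub>R v" by (auto simp: real_eigenvalues_def)
  define w where "w = transpose Q *v v"
  have "w \<noteq> 0" using v(1) orthogonal_matrix_mult_transpose(1)[OF Q, of v] by (auto simp: w_def)
  then obtain i where i: "w $ i \<noteq> 0" by (auto simp: vec_eq_iff)
  have "diag_mat l *v w = transpose Q *v (S *v v)"
    by (simp add: spectral_mult_vec w_def orthogonal_matrix_mult_transpose[OF Q])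
  also have "\<dots> = c *\<^sub>R w" by (simp add: v w_def matrix_vector_mult_scaleR)
  finally have "l i * w $ i = c * w $ i" by (simp add: diag_mat_mult_vec vec_eq_iff)
  with i show "c \<in> range l" by auto
next
  fix c assume "c \<in> range l"
  then obtain i where c: "c = l i" by auto
  define v where "v = Q *v axis i 1"
  have "v \<noteq> 0"
    using norm_orthogonal_matrix_mult[OF Q, of "axis i 1"] by (auto simp: v_def)
  moreover have "diag_mat l *v axis i 1 = l i *\<^sub>R axis i 1"
    by (auto simp: diag_mat_mult_vec vec_eq_iff axis_def)
  then have "S *v v = c *\<^sub>R v"
    by (simp add: spectral_mult_vec v_def c orthogonal_matrix_mult_transpose[OF Q] matrix_vector_mult_scaleR)
  ultimately show "c \<in> real_eigenvalues S" by (auto simp: real_eigenvalues_def)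
qed

lemma lambda_min_le_spectral: "lambda_min S \<le> l i"
  and spectral_le_lambda_max: "l i \<le> lambda_max S"
  by (simp_all add: lambda_min_def lambda_max_def real_eigenvalues_spectral)

lemma quadratic_form_spectral: "x \<bullet> (S *v x) = (\<Sum>i\<in>UNIV. l i * ((transpose Q *v x) $ i)\<^sup>2)"
proof -
  have "x \<bullet> (S *v x) = (transpose Q *v x) \<bullet> (diag_mat l *v (transpose Q *v x))"
    unfolding spectral_mult_vec by (metis dot_lmul_matrix transpose_matrix_vector)
  then show ?thesis by (simp add: inner_vec_def diag_mat_mult_vec power2_eq_square mult_ac)
qed

lemma norm_sq_spectral: "x \<bullet> x = (\<Sum>i\<in>UNIV. ((transpose Q *v x) $ i)\<^sup>2)"
proof -
  have "norm (transpose Q *v x) = norm x" using Q by (simp add: norm_orthogonal_matrix_mult)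
  then have "x \<bullet> x = (transpose Q *v x) \<bullet> (transpose Q *v x)" by (simp add: dot_square_norm)
  then show ?thesis by (simp add: inner_vec_def power2_eq_square)
qed

lemma spectral_pos_def: assumes "pos_def_mat S" shows "l i > 0"
proof -
  define x where "x = Q *v axis i 1"
  have eq: "transpose Q *v x = axis i 1" by (simp add: x_def orthogonal_matrix_mult_transpose[OF Q])
  then have "x \<noteq> 0" by auto
  then have "x \<bullet> (S *v x) > 0" using assms by (auto simp: pos_def_mat_def)
  then show ?thesis
    by (simp add: quadratic_form_spectral eq axis_def if_distrib[of "\<lambda>a. a\<^sup>2"]
        if_distrib[of "\<lambda>a. _ * a"] cong: if_cong)
qed

end

lemma rayleigh_bounds:
  fixes S :: "real^'n^'n"
  assumes "transpose S = S"
  shows "lambda_min S * (x \<bullet> x) \<le> x \<bullet> (S *v x)" "x \<bullet> (S *v x) \<le> lambda_max S * (x \<bullet> x)"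
proof -
  obtain Q l where Q: "orthogonal_matrix Q" "S = Q ** diag_mat l ** transpose Q"
    using symmetric_matrix_spectral[OF assms] .
  note [simp] = quadratic_form_spectral[OF Q] norm_sq_spectral[OF Q]
  show "lambda_min S * (x \<bullet> x) \<le> x \<bullet> (S *v x)"
    by (auto simp: sum_distrib_left intro!: sum_mono mult_right_mono lambda_min_le_spectral[OF Q])
  show "x \<bullet> (S *v x) \<le> lambda_max S * (x \<bullet> x)"
    by (auto simp: sum_distrib_left intro!: sum_mono mult_right_mono spectral_le_lambda_max[OF Q])
qed

text \<open>For fixed \<open>x\<close> the condition on the right is linear in the entries of
  \<open>S\<close>; this form is what yields measurability of \<open>lambda_max\<close>
  later.\<close>

lemma lambda_max_le_iff:
  fixes S :: "real^'n^'n"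
  assumes "transpose S = S"
  shows "lambda_max S \<le> c \<longleftrightarrow> (\<forall>x. x \<bullet> (S *v x) \<le> c * (x \<bullet> x))"
proof
  assume "lambda_max S \<le> c"
  then show "\<forall>x. x \<bullet> (S *v x) \<le> c * (x \<bullet> x)"
    using rayleigh_bounds(2)[OF assms] by (meson inner_ge_zero mult_right_mono order_trans)
next
  assume *: "\<forall>x. x \<bullet> (S *v x) \<le> c * (x \<bullet> x)"
  obtain Q l where Q: "orthogonal_matrix Q" "S = Q ** diag_mat l ** transpose Q"
    using symmetric_matrix_spectral[OF assms] .
  have "lambda_max S \<in> real_eigenvalues S"
    by (simp add: lambda_max_def real_eigenvalues_spectral[OF Q] Max_in)
  then obtain v where v: "v \<noteq> 0" "S *v v = lambda_max S *\<^sub>R v" by (auto simp: real_eigenvalues_def)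
  then have "lambda_max S * (v \<bullet> v) \<le> c * (v \<bullet> v)" using *[rule_format, of v] by simp
  then show "lambda_max S \<le> c" using v(1) by simp
qed

lemma lambda_max_pos:
  assumes "pos_def_mat S" shows "lambda_max S > 0"
proof -
  obtain Q l where Q: "orthogonal_matrix Q" "S = Q ** diag_mat l ** transpose Q"
    using symmetric_matrix_spectral[of S] assms by (auto simp: pos_def_mat_def)
  show ?thesis using spectral_pos_def[OF Q assms] spectral_le_lambda_max[OF Q] less_le_trans by blast
qed

text \<open>The trace is evaluated in an orthonormal basis containing \<open>u\<close>.\<close>
lemma trace_minus_rayleigh_ge:
  fixes S :: "real^'n^'n"
  assumes sym: "transpose S = S" and lam: "lam \<le> lambda_min S" and u: "norm u = 1"
  shows "(real CARD('n) - 1) * lam \<le> trace S - u \<bullet> (S *v u)"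
proof -
  obtain k :: 'n where True by simp
  obtain A where A: "orthogonal_matrix A" "A *v axis k 1 = u"
    using orthogonal_matrix_exists_basis[OF u] .
  define c where "c i = A *v axis i 1" for i
  have nc: "c i \<bullet> c i = 1" for i
    using norm_orthogonal_matrix_mult[OF A(1), of "axis i 1"] by (simp add: c_def dot_square_norm)
  have "trace S = trace (transpose A ** (S ** A))"
    using A(1) by (subst trace_mul_sym) (simp add: matrix_mul_assoc[symmetric] orthogonal_matrix_def)
  also have "\<dots> = (\<Sum>i\<in>UNIV. c i \<bullet> (S *v c i))"
  proof -
    have "(transpose A ** (S ** A)) $ i $ i = axis i 1 \<bullet> ((transpose A ** (S ** A)) *v axis i 1)" for i
      by (simp add: inner_axis' matrix_vector_mult_basis column_def)
    also have "\<dots> i = c i \<bullet> (S *v c i)" for i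
      unfolding c_def matrix_vector_mul_assoc[symmetric] by (metis dot_lmul_matrix vector_transpose_matrix)
    finally show ?thesis by (simp add: trace_def)
  qed
  also have "\<dots> = u \<bullet> (S *v u) + (\<Sum>i\<in>UNIV - {k}. c i \<bullet> (S *v c i))"
    by (subst sum.remove[of _ k]) (auto simp: c_def A(2))
  finally have "trace S - u \<bullet> (S *v u) = (\<Sum>i\<in>UNIV - {k}. c i \<bullet> (S *v c i))" by simp
  also have "\<dots> \<ge> (\<Sum>i\<in>UNIV - {k}. lam)"
    using rayleigh_bounds(1)[OF sym, of "c _"] lam by (intro sum_mono) (metis mult.right_neutral nc order_trans)
  finally show ?thesis by (simp add: of_nat_diff)
qed

subsection \<open>Gaussian measures on Euclidean space\<close>

lemma nn_integral_lborel_translate: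
  fixes f :: "'a::euclidean_space \<Rightarrow> ennreal"
  assumes [measurable]: "f \<in> borel_measurable borel"
  shows "(\<integral>\<^sup>+x. f (t + x) \<partial>lborel) = (\<integral>\<^sup>+x. f x \<partial>lborel)"
  by (subst (2) lborel_distr_plus[of t, symmetric]) (simp add: nn_integral_distr)

text \<open>Uniqueness of Haar measure: the image measure is translation invariant, so Fubini compares it
  with Lebesgue measure up to a constant, which the unit ball shows to be 1.\<close>
lemma lborel_distr_orthogonal_transformation:
  fixes f :: "'a::euclidean_space \<Rightarrow> 'a"
  assumes f: "orthogonal_transformation f"
  shows "distr lborel borel f = lborel"
proof (rule measure_eqI)
  fix A assume "A \<in> sets (distr lborel borel f)"
  then have A [measurable]: "A \<in> sets borel" by simp
  have lin: "linear f" using f by (rule orthogonal_transformation_linear)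
  have [measurable]: "f \<in> borel_measurable borel"
    using lin by (intro borel_measurable_continuous_onI linear_continuous_on linear_conv_bounded_linear[THEN iffD1])
  obtain g where g: "\<And>y. f (g y) = y"
    using orthogonal_transformation_surj[OF f] by (metis surjD)
  define B where "B = cball (0::'a) 1"
  have [measurable]: "B \<in> sets borel" by (simp add: B_def)
  have Bf: "indicator B (- f x) = (indicator B x :: ennreal)" for x
    using orthogonal_transformation_norm[OF f] by (simp add: B_def indicator_def)
  have "emeasure lborel (f -` A) * emeasure lborel B
      = (\<integral>\<^sup>+x. indicator A (f x) * emeasure lborel B \<partial>lborel)"
  proof -
    have "f -` A \<in> sets borel" using measurable_sets_borel[of f borel A] by simp
    moreover have "indicator A (f x) = (indicator (f -` A) x :: ennreal)" for x by (simp add: indicator_def)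
    ultimately show ?thesis by (simp add: nn_integral_multc)
  qed
  also have "\<dots> = (\<integral>\<^sup>+x. indicator A (f x) * (\<integral>\<^sup>+y. indicator B (- f x + y) \<partial>lborel) \<partial>lborel)"
    by (subst nn_integral_lborel_translate[where f="indicator B"]) simp_all
  also have "\<dots> = (\<integral>\<^sup>+x. (\<integral>\<^sup>+y. indicator A (f x) * indicator B (- f x + y) \<partial>lborel) \<partial>lborel)"
    by (subst nn_integral_cmult) simp_all
  also have "\<dots> = (\<integral>\<^sup>+y. (\<integral>\<^sup>+x. indicator A (f x) * indicator B (- f x + y) \<partial>lborel) \<partial>lborel)"
    by (rule lborel_pair.Fubini') measurable
  \<comment> \<open>For fixed \<open>y\<close> translate \<open>x\<close> by a preimage
    \<open>g y\<close>. By linearity \<open>y\<close> then moves from the ball indicator into the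
    argument of \<open>indicator A\<close>: \<open>- f (g y + x) + y\<close> becomes
    \<open>- f x\<close>, and the ball is invariant under \<open>- f\<close>.\<close>
  also have "\<dots> = (\<integral>\<^sup>+y. (\<integral>\<^sup>+x. indicator A (f (g y + x)) * indicator B (- f (g y + x) + y) \<partial>lborel) \<partial>lborel)"
    by (intro nn_integral_cong nn_integral_lborel_translate[symmetric]) measurable
  also have "\<dots> = (\<integral>\<^sup>+y. (\<integral>\<^sup>+x. indicator A (f x + y) * indicator B x \<partial>lborel) \<partial>lborel)"
    by (simp add: linear_add[OF lin] g Bf add.commute)
  also have "\<dots> = (\<integral>\<^sup>+x. (\<integral>\<^sup>+y. indicator A (f x + y) * indicator B x \<partial>lborel) \<partial>lborel)"
    by (rule lborel_pair.Fubini') measurable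
  also have "\<dots> = (\<integral>\<^sup>+x. (\<integral>\<^sup>+y. indicator A (f x + y) \<partial>lborel) * indicator B x \<partial>lborel)"
    by (subst nn_integral_multc) simp_all
  also have "\<dots> = emeasure lborel A * emeasure lborel B"
    by (subst nn_integral_lborel_translate[where f="indicator A"]) (simp_all add: nn_integral_cmult)
  finally have eq: "emeasure lborel (f -` A) * emeasure lborel B = emeasure lborel A * emeasure lborel B" .
  have "emeasure lborel B = ennreal (unit_ball_vol DIM('a))" by (simp add: B_def emeasure_cball)
  then have "emeasure lborel B \<noteq> 0" "emeasure lborel B \<noteq> \<infinity>"
    using unit_ball_vol_pos[of "real DIM('a)"] by (auto simp del: unit_ball_vol_pos)
  with eq have "emeasure lborel (f -` A) = emeasure lborel A"
    by (metis ennreal_mult_divide_eq infinity_ennreal_def)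
  then show "emeasure (distr lborel borel f) A = emeasure lborel A"
    by (simp add: emeasure_distr)
qed simp

lemma bij_betw_axis_Basis: "bij_betw (\<lambda>i. axis i (1::real)) (UNIV :: 'n::finite set) Basis"
  by (auto simp: bij_betw_def inj_on_def axis_eq_axis Basis_vec_def)

text \<open>Substitution rule for a diagonal map, written with \<open>lborel\<close> alone on the
  left so that it can be rewritten inside an integral.\<close>

lemma lborel_diag_mat:
  fixes l :: "'n::finite \<Rightarrow> real"
  assumes "\<And>i. l i \<noteq> 0"
  shows "lborel = density (distr lborel borel ((*v) (diag_mat l))) (\<lambda>_. ennreal (\<Prod>i\<in>UNIV. \<bar>l i\<bar>))"
proof -
  define w where "w = (\<chi> i. l i)"
  have "(\<lambda>x. 0 + (\<Sum>j\<in>Basis. (w \<bullet> j * (x \<bullet> j)) *\<^sub>R j)) = (*v) (diag_mat l)"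
  proof (rule ext, rule euclidean_eqI)
    fix x b :: "real^'n" assume b: "b \<in> Basis"
    then obtain i where i: "b = axis i 1" by (auto simp: Basis_vec_def)
    have "(\<Sum>j\<in>Basis. (w \<bullet> j * (x \<bullet> j)) *\<^sub>R j) \<bullet> b = w \<bullet> b * (x \<bullet> b)"
      using b by (rule inner_sum_left_Basis)
    also have "\<dots> = (diag_mat l *v x) \<bullet> b"
      by (simp add: i inner_axis w_def diag_mat_mult_vec)
    finally show "(0 + (\<Sum>j\<in>Basis. (w \<bullet> j * (x \<bullet> j)) *\<^sub>R j)) \<bullet> b = (diag_mat l *v x) \<bullet> b" by simp
  qed
  moreover have "(\<Prod>j\<in>Basis. \<bar>w \<bullet> j\<bar>) = (\<Prod>i\<in>UNIV. \<bar>l i\<bar>)"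
    by (subst prod.reindex_bij_betw[OF bij_betw_axis_Basis, symmetric]) (simp add: inner_axis w_def)
  moreover have "w \<bullet> j \<noteq> 0" if "j \<in> Basis" for j
    using that assms by (auto simp: Basis_vec_def inner_axis w_def)
  ultimately show ?thesis using lborel_affine_euclidean[of "\<lambda>j. w \<bullet> j" 0] by simp
qed

section \<open>Normal laws as linear images of the standard normal law\<close>

lemma matrix_inv_eqI:
  fixes A B :: "real^'n^'n"
  assumes "A ** B = mat 1" shows "matrix_inv A = B"
proof -
  have BA: "B ** A = mat 1" using assms by (simp add: matrix_left_right_inverse)
  have "invertible A" using assms BA by (auto simp: invertible_def)
  then have inv: "A ** matrix_inv A = mat 1 \<and> matrix_inv A ** A = mat 1"
    unfolding matrix_inv_def invertible_def by (rule someI_ex)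
  have "matrix_inv A = (B ** A) ** matrix_inv A" by (simp add: BA)
  also have "\<dots> = B" by (simp add: inv matrix_mul_assoc[symmetric])
  finally show ?thesis .
qed

lemma matrix_inv_mat_1: "matrix_inv (mat 1 :: real^'n^'n) = mat 1"
  by (rule matrix_inv_eqI) simp

lemma mvn_density_std: "mvn_density (mat 1) x = exp (- (norm x)\<^sup>2 / 2) / sqrt ((2 * pi) ^ CARD('n))"
  for x :: "real^'n"
  by (simp add: mvn_density_def matrix_inv_mat_1 dot_square_norm)

lemma borel_measurable_matrix_vector_mult [measurable]: "(*v) (A :: real^'n^'m) \<in> borel_measurable borel"
  by (intro borel_measurable_continuous_onI linear_continuous_on matrix_vector_mul_bounded_linear)

lemma borel_measurable_mvn_density [measurable]: "mvn_density S \<in> borel_measurable borel"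
  unfolding mvn_density_def by measurable

lemma sets_normal_vec [measurable_cong, simp]: "sets (normal_vec S) = sets borel"
  and space_normal_vec [simp]: "space (normal_vec S) = UNIV"
  by (simp_all add: normal_vec_def)

lemma sqrt_prod: "sqrt (\<Prod>i\<in>A. f i) = (\<Prod>i\<in>A. sqrt (f i))"
  by (induction A rule: infinite_finite_induct) (simp_all add: real_sqrt_mult)

context
  fixes Q S :: "real^'n^'n" and l :: "'n \<Rightarrow> real"
  assumes Q: "orthogonal_matrix Q" and S: "S = Q ** diag_mat l ** transpose Q" and l: "\<And>i. l i > 0"
begin

lemma det_spectral: "det S = (\<Prod>i\<in>UNIV. l i)"
proof -
  have "det Q * det Q = det (Q ** transpose Q)" by (simp add: det_mul)
  also have "\<dots> = 1" using Q by (simp add: orthogonal_matrix_def)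
  finally show ?thesis by (simp add: S det_mul det_diag_mat)
qed

lemma matrix_inv_spectral: "matrix_inv S = Q ** diag_mat (\<lambda>i. 1 / l i) ** transpose Q"
proof (rule matrix_inv_eqI)
  have "diag_mat l ** diag_mat (\<lambda>i. 1 / l i) = mat 1"
    using l by (simp add: diag_mat_mult_diag_mat less_imp_neq[THEN not_sym]) (simp add: diag_mat_def mat_def)
  then have "diag_mat l *v (diag_mat (\<lambda>i. 1 / l i) *v x) = x" for x
    by (simp add: matrix_vector_mul_assoc)
  then show "S ** (Q ** diag_mat (\<lambda>i. 1 / l i) ** transpose Q) = mat 1"
    using Q by (simp add: matrix_eq S matrix_vector_mul_assoc[symmetric] orthogonal_matrix_mult_transpose)
qed

text \<open>Under the substitution the quadratic form of \<open>matrix_inv S\<close> becomes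
  \<open>(norm y)\<^sup>2\<close>, and the Jacobian, the product of the \<open>sqrt (l i)\<close>,
  cancels \<open>sqrt (det S)\<close>.\<close>

lemma mvn_density_spectral:
  "(\<Prod>i\<in>UNIV. sqrt (l i)) * mvn_density S (Q *v (diag_mat (\<lambda>i. sqrt (l i)) *v y)) = mvn_density (mat 1) y"
proof -
  let ?L = "diag_mat (\<lambda>i. sqrt (l i))"
  have "(Q *v (?L *v y)) \<bullet> (matrix_inv S *v (Q *v (?L *v y)))
      = (Q *v (?L *v y)) \<bullet> (Q *v (diag_mat (\<lambda>i. 1 / l i) *v (?L *v y)))"
    unfolding matrix_inv_spectral
    using Q by (simp add: matrix_vector_mul_assoc[symmetric] orthogonal_matrix_mult_transpose)
  also have "\<dots> = (?L *v y) \<bullet> (diag_mat (\<lambda>i. 1 / l i) *v (?L *v y))"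
    using Q orthogonal_transformation_matrix[of "(*v) Q"] by (simp add: orthogonal_transformation_def)
  also have "\<dots> = (\<Sum>i\<in>UNIV. (sqrt (l i))\<^sup>2 * (y $ i)\<^sup>2 / l i)"
    by (simp add: inner_vec_def diag_mat_mult_vec power2_eq_square mult_ac del: real_sqrt_mult_self)
  also have "\<dots> = y \<bullet> y"
    using l by (simp add: less_imp_le less_imp_neq[THEN not_sym] inner_vec_def power2_eq_square)
  also have "\<dots> = (norm y)\<^sup>2" by (simp add: power2_norm_eq_inner)
  finally have *: "(Q *v (?L *v y)) \<bullet> (matrix_inv S *v (Q *v (?L *v y))) = (norm y)\<^sup>2" .
  have "sqrt (det S) = (\<Prod>i\<in>UNIV. sqrt (l i))" by (simp add: det_spectral sqrt_prod)
  moreover have "(\<Prod>i\<in>UNIV. sqrt (l i)) > 0" using l by (simp add: prod_pos)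
  ultimately show ?thesis using l by (simp add: less_imp_neq[THEN not_sym] mvn_density_std mvn_density_def[of S] * real_sqrt_mult)
qed

lemma normal_vec_spectral:
  "normal_vec S = distr (normal_vec (mat 1)) borel (\<lambda>y. Q *v (diag_mat (\<lambda>i. sqrt (l i)) *v y))"
proof (rule measure_eqI)
  fix X assume "X \<in> sets (normal_vec S)"
  then have [measurable]: "X \<in> sets borel" by simp
  let ?L = "diag_mat (\<lambda>i. sqrt (l i))"
  let ?F = "\<lambda>x. ennreal (mvn_density S x) * indicator X x"
  have ot: "orthogonal_transformation ((*v) Q)" using Q by (simp add: orthogonal_transformation_matrix)
  have pos: "(\<Prod>i\<in>UNIV. sqrt (l i)) \<ge> 0" using l by (simp add: prod_nonneg less_imp_le)
  have "emeasure (normal_vec S) X = (\<integral>\<^sup>+x. ?F x \<partial>lborel)"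
    by (simp add: normal_vec_def emeasure_density)
  also have "\<dots> = (\<integral>\<^sup>+x. ?F (Q *v x) \<partial>lborel)"
    by (subst lborel_distr_orthogonal_transformation[OF ot, symmetric]) (simp add: nn_integral_distr)
  also have "\<dots> = (\<integral>\<^sup>+y. ennreal (\<Prod>i\<in>UNIV. sqrt (l i)) * ?F (Q *v (?L *v y)) \<partial>lborel)"
    using l by (subst lborel_diag_mat[of "\<lambda>i. sqrt (l i)"])
      (auto simp: nn_integral_density nn_integral_distr less_imp_neq[THEN not_sym] less_imp_le)
  also have "\<dots> = (\<integral>\<^sup>+y. ennreal (mvn_density (mat 1) y) * indicator X (Q *v (?L *v y)) \<partial>lborel)"
    unfolding mvn_density_spectral[symmetric] using pos by (simp add: ennreal_mult' mult.assoc)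
  also have "\<dots> = emeasure (distr (normal_vec (mat 1)) borel (\<lambda>y. Q *v (?L *v y))) X"
  proof -
    have "(\<lambda>y. Q *v (?L *v y)) -` X \<in> sets borel"
      by (rule measurable_sets_borel[of _ borel]) measurable
    moreover have "indicator X (Q *v (?L *v y)) = (indicator ((\<lambda>y. Q *v (?L *v y)) -` X) y :: ennreal)" for y
      by (simp add: indicator_def)
    ultimately show ?thesis by (simp add: emeasure_distr normal_vec_def emeasure_density)
  qed
  finally show "emeasure (normal_vec S) X = emeasure (distr (normal_vec (mat 1)) borel (\<lambda>y. Q *v (?L *v y))) X" .
qed simp

end

text \<open>The matrix is a square root in the sense \<open>A ** transpose A = S\<close>. It
  realises every normal law as an image of the single standard one, so that laws with different
  covariances can be compared pointwise in \<open>y\<close>.\<close>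

lemma normal_vec_sqrt:
  fixes S :: "real^'n^'n"
  assumes "pos_def_mat S"
  obtains A :: "real^'n^'n" where "normal_vec S = distr (normal_vec (mat 1)) borel ((*v) A)"
    "\<And>y. norm (A *v y) \<le> sqrt (lambda_max S) * norm y"
proof -
  obtain Q l where Q: "orthogonal_matrix Q" "S = Q ** diag_mat l ** transpose Q"
    using symmetric_matrix_spectral[of S] assms by (auto simp: pos_def_mat_def)
  have l: "l i > 0" for i by (rule spectral_pos_def[OF Q assms])
  define A where "A = Q ** diag_mat (\<lambda>i. sqrt (l i))"
  have "normal_vec S = distr (normal_vec (mat 1)) borel ((*v) A)"
    unfolding A_def by (subst normal_vec_spectral[OF Q l]) (simp_all add: matrix_vector_mul_assoc)
  moreover have "norm (A *v y) \<le> sqrt (lambda_max S) * norm y" for y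
  proof -
    have "(norm (A *v y))\<^sup>2 = (norm (diag_mat (\<lambda>i. sqrt (l i)) *v y))\<^sup>2"
      by (simp add: A_def matrix_vector_mul_assoc[symmetric] norm_orthogonal_matrix_mult[OF Q(1)])
    also have "\<dots> = (\<Sum>i\<in>UNIV. l i * (y $ i)\<^sup>2)"
      using l by (simp add: power2_norm_eq_inner inner_vec_def diag_mat_mult_vec less_imp_le
          power_mult_distrib power2_eq_square[symmetric])
    also have "\<dots> \<le> (\<Sum>i\<in>UNIV. lambda_max S * (y $ i)\<^sup>2)"
      by (intro sum_mono mult_right_mono spectral_le_lambda_max[OF Q]) auto
    also have "\<dots> = lambda_max S * (y \<bullet> y)"
      by (simp add: inner_vec_def sum_distrib_left power2_eq_square)
    finally have "sqrt ((norm (A *v y))\<^sup>2) \<le> sqrt (lambda_max S * (y \<bullet> y))"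
      by (rule real_sqrt_le_mono)
    then show ?thesis by (simp add: real_sqrt_mult norm_eq_sqrt_inner[symmetric])
  qed
  ultimately show ?thesis using that by blast
qed

section \<open>Polar coordinates for the standard normal law\<close>

text \<open>Half-lines \<open>{..r}\<close> determine the measure: for \<open>r \<ge> 0\<close>
  their preimages under \<open>norm\<close> are balls of volume
  \<open>unit_ball_vol DIM('a) * r ^ DIM('a)\<close>, and the density is the derivative of that
  volume.\<close>

lemma distr_norm_lborel:
  "distr (lborel :: 'a::euclidean_space measure) borel norm
    = density lborel (\<lambda>r. ennreal (real DIM('a) * unit_ball_vol DIM('a) * r ^ (DIM('a) - 1)) * indicator {0..} r)"
  (is "?M = ?N")
proof (rule measure_eqI_generator_eq[where E="range atMost" and \<Omega>=UNIV and A="\<lambda>i. {..real i}"])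
  let ?d = "DIM('a)" let ?c = "unit_ball_vol DIM('a)"
  have M: "emeasure ?M {..r} = ennreal (if r < 0 then 0 else ?c * r ^ ?d)" for r
  proof -
    have "norm -` {..r} = cball (0::'a) r" by auto
    then show ?thesis by (auto simp: emeasure_distr emeasure_cball)
  qed
  show "emeasure ?M X = emeasure ?N X" if "X \<in> range atMost" for X
  proof -
    from that obtain r where X: "X = {..r}" by auto
    have "emeasure ?N X = (\<integral>\<^sup>+s. ennreal (?d * ?c * s ^ (?d - 1)) * indicator {0..r} s \<partial>lborel)"
      unfolding X by (subst emeasure_density) (auto intro!: nn_integral_cong simp: indicator_def)
    also have "\<dots> = ennreal (if r < 0 then 0 else ?c * r ^ ?d)"
    proof (cases "r < 0")
      case False
      have "((\<lambda>s. ?c * s ^ ?d) has_real_derivative ?d * ?c * s ^ (?d - 1)) (at s)" for s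
        by (auto intro!: derivative_eq_intros)
      then show ?thesis using False
        by (subst nn_integral_FTC_Icc[where F="\<lambda>s. ?c * s ^ ?d"]) (auto intro: has_field_derivative_at_within)
    qed simp
    finally show ?thesis by (simp add: X M)
  qed
  show "emeasure ?M {..real i} \<noteq> \<infinity>" for i by (simp only: M) simp
  show "Int_stable (range (atMost :: real \<Rightarrow> _))" by (auto simp: Int_stable_def)
  show "(\<Union>i. {..real i}) = UNIV" using real_arch_simple by auto
qed (auto simp: borel_eq_atMost)

text \<open>Here \<open>n * unit_ball_vol n\<close> is the area of the unit sphere and the root is
  the Gaussian normalisation; their ratio is the constant of the chi density. The denominator on the
  right, times \<open>d\<close>, is that of \<open>gamma_const\<close>.\<close>

lemma unit_ball_vol_gaussian_normalization:
  assumes "n > 0"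
  shows "real n * unit_ball_vol n / sqrt ((2 * pi) ^ n) = 1 / (2 powr (real n / 2 - 1) * Gamma (real n / 2))"
proof -
  have "Gamma (real n / 2 + 1) = real n / 2 * Gamma (real n / 2)"
    using assms by (subst Gamma_plus1) (auto elim!: nonpos_Ints_cases)
  moreover have "sqrt ((2 * pi) ^ n) = 2 powr (real n / 2) * pi powr (real n / 2)"
    by (simp add: powr_half_sqrt[symmetric] powr_realpow[symmetric] powr_powr powr_mult)
  moreover have "Gamma (real n / 2) > 0" using assms by (simp add: Gamma_real_pos)
  moreover have "2 powr (real n / 2 - 1) = 2 powr (real n / 2) / (2::real)" by (simp add: powr_diff)
  ultimately show ?thesis using assms by (simp only: unit_ball_vol_def) (simp add: field_simps)
qed

text \<open>The weight is the chi density with \<open>CARD('n)\<close> degrees of freedom.\<close>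

lemma nn_integral_std_normal_radial:
  fixes g :: "real \<Rightarrow> ennreal"
  assumes [measurable]: "g \<in> borel_measurable borel"
  shows "(\<integral>\<^sup>+y. g (norm y) \<partial>normal_vec (mat 1 :: real^'n^'n))
    = (\<integral>\<^sup>+r. ennreal (r ^ (CARD('n) - 1) * exp (- r\<^sup>2 / 2) / (2 powr (real CARD('n) / 2 - 1) * Gamma (real CARD('n) / 2)))
        * g r * indicator {0..} r \<partial>lborel)"
proof -
  let ?n = "CARD('n)"
  let ?G = "\<lambda>r. ennreal (exp (- r\<^sup>2 / 2) / sqrt ((2 * pi) ^ ?n)) * g r"
  have n: "?n > 0" by simp
  have "(\<integral>\<^sup>+y. g (norm y) \<partial>normal_vec (mat 1 :: real^'n^'n)) = (\<integral>\<^sup>+y. ?G (norm (y::real^'n)) \<partial>lborel)"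
    by (simp add: normal_vec_def nn_integral_density mvn_density_std)
  also have "\<dots> = (\<integral>\<^sup>+r. ?G r \<partial>distr (lborel :: (real^'n) measure) borel norm)"
    by (simp add: nn_integral_distr)
  also have "\<dots> = (\<integral>\<^sup>+r. ennreal (real ?n * unit_ball_vol ?n * r ^ (?n - 1)) * indicator {0..} r * ?G r \<partial>lborel)"
    by (simp add: distr_norm_lborel nn_integral_density)
  also have "\<dots> = (\<integral>\<^sup>+r. ennreal (r ^ (?n - 1) * exp (- r\<^sup>2 / 2) / (2 powr (real ?n / 2 - 1) * Gamma (real ?n / 2)))
        * g r * indicator {0..} r \<partial>lborel)"
  proof (intro nn_integral_cong)
    fix r :: real
    have "ennreal (real ?n * unit_ball_vol ?n * r ^ (?n - 1)) * ennreal (exp (- r\<^sup>2 / 2) / sqrt ((2 * pi) ^ ?n))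
      = ennreal (r ^ (?n - 1) * exp (- r\<^sup>2 / 2) / (2 powr (real ?n / 2 - 1) * Gamma (real ?n / 2)))" if "r \<ge> 0"
    proof -
      have "real ?n * unit_ball_vol ?n * r ^ (?n - 1) * (exp (- r\<^sup>2 / 2) / sqrt ((2 * pi) ^ ?n))
        = r ^ (?n - 1) * exp (- r\<^sup>2 / 2) * (real ?n * unit_ball_vol ?n / sqrt ((2 * pi) ^ ?n))" by simp
      also have "\<dots> = r ^ (?n - 1) * exp (- r\<^sup>2 / 2) / (2 powr (real ?n / 2 - 1) * Gamma (real ?n / 2))"
        by (simp only: unit_ball_vol_gaussian_normalization[OF n]) simp
      finally show ?thesis using that by (subst ennreal_mult[symmetric]) (simp_all only:, auto)
    qed
    then show "ennreal (real ?n * unit_ball_vol ?n * r ^ (?n - 1)) * indicator {0..} r * ?G r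
      = ennreal (r ^ (?n - 1) * exp (- r\<^sup>2 / 2) / (2 powr (real ?n / 2 - 1) * Gamma (real ?n / 2))) * g r * indicator {0..} r"
      by (auto simp: indicator_def mult.assoc[symmetric])
  qed
  finally show ?thesis .
qed

text \<open>Substitute \<open>t = r\<^sup>2 / 2\<close> in the Euler integral for
  \<open>Gamma ((j + 1) / 2)\<close>. These moments supply the Gamma values in
  \<open>gamma_const\<close>.\<close>

lemma has_integral_gaussian_moment:
  "((\<lambda>r. r ^ j * exp (- r\<^sup>2 / 2)) has_integral (2 powr ((real j - 1) / 2) * Gamma ((real j + 1) / 2))) {0..}"
proof -
  define x where "x = (real j + 1) / 2"
  define f where "f t = t powr (x - 1) / exp t" for t :: real
  have G: "(f has_integral Gamma x) {0..}"
    unfolding f_def by (rule Gamma_integral_real) (simp add: x_def)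
  have img: "(\<lambda>r::real. r\<^sup>2 / 2) ` {0..} = {0..}"
  proof (intro equalityI subsetI)
    fix y :: real assume "y \<in> {0..}"
    then show "y \<in> (\<lambda>r. r\<^sup>2 / 2) ` {0..}" by (intro image_eqI[of _ _ "sqrt (2 * y)"]) auto
  qed auto
  have "f absolutely_integrable_on {0..}"
    using G by (intro nonnegative_absolutely_integrable_1) (auto simp: f_def has_integral_integrable)
  then have "f absolutely_integrable_on (\<lambda>r::real. r\<^sup>2 / 2) ` {0..} \<and> integral ((\<lambda>r::real. r\<^sup>2 / 2) ` {0..}) f = Gamma x"
    using G by (simp add: img integral_unique)
  moreover have "inj_on (\<lambda>r::real. r\<^sup>2 / 2) {0..}"
    by (auto simp: inj_on_def)
  ultimately have "(\<lambda>r. \<bar>r\<bar> * f (r\<^sup>2 / 2)) absolutely_integrable_on {0..} \<and> integral {0..} (\<lambda>r. \<bar>r\<bar> * f (r\<^sup>2 / 2)) = Gamma x"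
    by (subst has_absolute_integral_change_of_variables_1') (auto intro!: derivative_eq_intros)
  then have "((\<lambda>r. \<bar>r\<bar> * f (r\<^sup>2 / 2)) has_integral Gamma x) {0..}"
    by (auto simp: has_integral_iff dest: set_lebesgue_integral_eq_integral(1))
  then have scaled: "((\<lambda>r. 2 powr (x - 1) * (\<bar>r\<bar> * f (r\<^sup>2 / 2))) has_integral (2 powr (x - 1) * Gamma x)) {0..}"
    by (rule has_integral_mult_right)
  \<comment> \<open>The point 0 is left out: for \<open>j = 0\<close> the left side is 1 there while
    the factor \<open>\<bar>r\<bar>\<close> makes the right side 0. A single point is
    negligible.\<close>
  have "r ^ j * exp (- r\<^sup>2 / 2) = 2 powr (x - 1) * (\<bar>r\<bar> * f (r\<^sup>2 / 2))" if "r \<in> {0..} - {0}" for r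
  proof -
    have r: "r > 0" using that by auto
    have "(r\<^sup>2 / 2) powr (x - 1) = r powr (2 * (x - 1)) / 2 powr (x - 1)"
      using r by (simp add: powr_divide powr_powr powr_realpow[symmetric] del: powr_numeral)
    moreover have "r * r powr (2 * (x - 1)) = r ^ j"
    proof -
      have "r * r powr (2 * (x - 1)) = r powr 1 * r powr (2 * (x - 1))" using r by simp
      also have "\<dots> = r powr real j" unfolding powr_add[symmetric] by (simp add: x_def field_simps)
      finally show ?thesis using r by (simp add: powr_realpow)
    qed
    ultimately show ?thesis using r by (simp add: f_def exp_minus field_simps)
  qed
  then have "((\<lambda>r. r ^ j * exp (- r\<^sup>2 / 2)) has_integral (2 powr (x - 1) * Gamma x)) {0..}"
    by (rule has_integral_spike[OF negligible_sing _ scaled])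
  then show ?thesis by (simp add: x_def diff_divide_distrib add_divide_distrib)
qed

text \<open>In polar coordinates the total mass is the radial moment of order
  \<open>CARD('n) - 1\<close> divided by \<open>?C\<close>, and \<open>?C\<close> is that
  moment.\<close>

lemma prob_space_normal_vec_std: "prob_space (normal_vec (mat 1 :: real^'n^'n))"
proof
  let ?n = "CARD('n)" let ?C = "2 powr (real ?n / 2 - 1) * Gamma (real ?n / 2)"
  have C: "?C > 0" "Gamma (real ?n / 2) \<noteq> 0" by (simp_all add: Gamma_real_pos less_imp_neq[THEN not_sym])
  have "((\<lambda>r. r ^ (?n - 1) * exp (- r\<^sup>2 / 2) / ?C) has_integral 1) {0..}"
    using has_integral_divide[OF has_integral_gaussian_moment[of "?n - 1"], of ?C] C(2)
    by (simp add: of_nat_diff diff_divide_distrib)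
  then have "(\<integral>\<^sup>+y. 1 \<partial>normal_vec (mat 1 :: real^'n^'n)) = 1"
    using C by (subst nn_integral_std_normal_radial[of "\<lambda>_. 1"], simp)
      (subst mult_1_right, subst nn_integral_has_integral_lebesgue', auto)
  then show "emeasure (normal_vec (mat 1 :: real^'n^'n)) (space (normal_vec (mat 1 :: real^'n^'n))) = 1"
    by simp
qed

lemma prob_space_normal_vec:
  fixes S :: "real^'n^'n"
  assumes "pos_def_mat S" shows "prob_space (normal_vec S)"
proof -
  obtain A :: "real^'n^'n" where A: "normal_vec S = distr (normal_vec (mat 1)) borel ((*v) A)"
    by (rule normal_vec_sqrt[OF assms])
  show ?thesis unfolding A by (rule prob_space.prob_space_distr[OF prob_space_normal_vec_std]) measurable
qed

lemma nn_integral_std_normal_norm_sq: "(\<integral>\<^sup>+y. ennreal ((norm y)\<^sup>2) \<partial>normal_vec (mat 1 :: real^'n^'n)) < \<infinity>"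
proof -
  let ?n = "CARD('n)" let ?C = "2 powr (real ?n / 2 - 1) * Gamma (real ?n / 2)"
  have C: "?C > 0" by (simp add: Gamma_real_pos)
  note * = has_integral_divide[OF has_integral_gaussian_moment[of "?n + 1"], of ?C]
  have "(\<integral>\<^sup>+y. ennreal ((norm y)\<^sup>2) \<partial>normal_vec (mat 1 :: real^'n^'n))
     = (\<integral>\<^sup>+r. ennreal (r ^ (?n + 1) * exp (- r\<^sup>2 / 2) / ?C) * indicator {0..} r \<partial>lborel)"
  proof (subst nn_integral_std_normal_radial[of "\<lambda>r. ennreal (r\<^sup>2)"], measurable, intro nn_integral_cong)
    fix r :: real
    have "r ^ (?n - 1) * r\<^sup>2 = r ^ (?n + 1)" by (subst power_add[symmetric]) simp
    moreover have "r ^ (?n - 1) * exp (- r\<^sup>2 / 2) / ?C * r\<^sup>2 = r ^ (?n - 1) * r\<^sup>2 * exp (- r\<^sup>2 / 2) / ?C"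
      by simp
    ultimately show "ennreal (r ^ (?n - 1) * exp (- r\<^sup>2 / 2) / ?C) * ennreal (r\<^sup>2) * indicator {0..} r
      = ennreal (r ^ (?n + 1) * exp (- r\<^sup>2 / 2) / ?C) * indicator {0..} r"
      by (subst ennreal_mult''[symmetric]) (simp_all only: zero_le_power2)
  qed
  also have "\<dots> < \<infinity>"
    using C by (subst nn_integral_has_integral_lebesgue'[OF _ *]) auto
  finally show ?thesis .
qed

subsection \<open>Stein's identity\<close>

lemma pos_def_mat_matrix_inv:
  fixes S :: "real^'n^'n"
  assumes "pos_def_mat S"
  shows "S ** matrix_inv S = mat 1" "matrix_inv S ** S = mat 1" "det S \<noteq> 0"
proof -
  have "\<forall>x. S *v x = 0 \<longrightarrow> x = 0"
    using assms by (force simp: pos_def_mat_def)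
  then have "invertible S" by (simp add: invertible_left_inverse matrix_left_invertible_ker)
  then have "S ** matrix_inv S = mat 1 \<and> matrix_inv S ** S = mat 1"
    unfolding matrix_inv_def invertible_def by (rule someI_ex)
  then show "S ** matrix_inv S = mat 1" "matrix_inv S ** S = mat 1" by simp_all
  show "det S \<noteq> 0" using \<open>invertible S\<close> by (simp add: invertible_det_nz)
qed

lemma pos_def_mat_selfadjoint:
  assumes "pos_def_mat S" shows "(S *v x) \<bullet> y = x \<bullet> (S *v y)"
proof -
  have "transpose S = S" using assms by (simp add: pos_def_mat_def)
  then show ?thesis by (metis dot_lmul_matrix vector_transpose_matrix)
qed

lemma mvn_density_nonneg [simp]: "pos_def_mat S \<Longrightarrow> 0 \<le> mvn_density S x"
proof -
  assume S: "pos_def_mat S"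
  obtain Q l where Q: "orthogonal_matrix Q" "S = Q ** diag_mat l ** transpose Q"
    using symmetric_matrix_spectral[of S] S by (auto simp: pos_def_mat_def)
  have "det S \<ge> 0"
    using spectral_pos_def[OF Q S] by (simp add: det_spectral[OF Q] prod_nonneg less_imp_le)
  then show ?thesis by (simp add: mvn_density_def)
qed

text \<open>The exponential tilt of Cameron and Martin. The shift has the form \<open>S *v a\<close>
  because then \<open>matrix_inv S\<close> cancels and the cross term is a multiple of
  \<open>a \<bullet> x\<close>. Translating the density thus costs an explicit factor that can be
  differentiated in \<open>t\<close>.\<close>

lemma mvn_density_shift:
  fixes S :: "real^'n^'n"
  assumes S: "pos_def_mat S"
  shows "mvn_density S (x - t *\<^sub>R (S *v a))
    = mvn_density S x * exp (t * (a \<bullet> x) - t\<^sup>2 * (a \<bullet> (S *v a)) / 2)"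
proof -
  let ?M = "matrix_inv S" and ?v = "S *v a"
  have Mv: "?M *v ?v = a" and SM: "S *v (?M *v y) = y" for y
    by (simp_all add: matrix_vector_mul_assoc pos_def_mat_matrix_inv[OF S])
  have vM: "?v \<bullet> (?M *v x) = a \<bullet> x"
    by (simp add: pos_def_mat_selfadjoint[OF S] SM)
  have "(x - t *\<^sub>R ?v) \<bullet> (?M *v (x - t *\<^sub>R ?v)) = x \<bullet> (?M *v x) - 2 * t * (a \<bullet> x) + t\<^sup>2 * (a \<bullet> ?v)"
    by (simp add: matrix_vector_mult_diff_distrib matrix_vector_mult_scaleR Mv vM inner_diff inner_commute[of x a]
        inner_commute[of ?v a] algebra_simps power2_eq_square)
  then show ?thesis
    by (simp add: mvn_density_def exp_add[symmetric] field_simps)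
qed

lemma integrable_lborel_translate_iff:
  fixes f :: "'a::euclidean_space \<Rightarrow> real"
  assumes [measurable]: "f \<in> borel_measurable borel"
  shows "integrable lborel (\<lambda>x. f (t + x)) \<longleftrightarrow> integrable lborel f"
  by (subst (2) lborel_distr_plus[of t, symmetric]) (simp add: integrable_distr_eq)

lemma integral_lborel_translate:
  fixes f :: "'a::euclidean_space \<Rightarrow> real"
  assumes [measurable]: "f \<in> borel_measurable borel"
  shows "(\<integral>x. f (t + x) \<partial>lborel) = (\<integral>x. f x \<partial>lborel)"
  by (subst (2) lborel_distr_plus[of t, symmetric]) (simp add: integral_distr)

lemma integrable_mvn_density:
  assumes "pos_def_mat S" shows "integrable lborel (mvn_density S)"
proof (rule integrableI_nonneg)
  have "emeasure (normal_vec S) UNIV = 1"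
    using prob_space.emeasure_space_1[OF prob_space_normal_vec[OF assms]] by simp
  then show "(\<integral>\<^sup>+x. ennreal (mvn_density S x) \<partial>lborel) < \<infinity>"
    by (simp add: normal_vec_def emeasure_density)
qed (use assms in simp_all)

text \<open>Read backwards, \<open>mvn_density_shift\<close> says that the tilted density is a
  constant multiple of a translated density, which is integrable.\<close>

lemma integrable_mvn_density_exp:
  fixes S :: "real^'n^'n"
  assumes S: "pos_def_mat S"
  shows "integrable lborel (\<lambda>x. mvn_density S x * exp (s * (a \<bullet> x)))"
proof -
  have "integrable lborel (\<lambda>x. mvn_density S (- (s *\<^sub>R (S *v a)) + x) * exp (s\<^sup>2 * (a \<bullet> (S *v a)) / 2))"
    by (intro integrable_mult_left, subst integrable_lborel_translate_iff)
       (auto intro: integrable_mvn_density[OF S])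
  moreover have "mvn_density S (- (s *\<^sub>R (S *v a)) + x) * exp (s\<^sup>2 * (a \<bullet> (S *v a)) / 2)
      = mvn_density S x * exp (s * (a \<bullet> x))" for x
    using mvn_density_shift[OF S, of x s a] by (simp add: exp_diff)
  ultimately show ?thesis by (simp only:)
qed

text \<open>Divided by \<open>t\<close>, with \<open>s\<close> of order \<open>t\<close>, this
  bounds the difference quotients of the tilt uniformly in \<open>t\<close>.\<close>

lemma abs_exp_minus_one_le: "\<bar>exp s - 1\<bar> \<le> \<bar>s\<bar> * exp \<bar>s\<bar>" for s :: real
proof (cases "s \<ge> 0")
  case True
  have "(1 - s) * exp s \<le> exp (- s) * exp s"
    using exp_ge_add_one_self[of "- s"] by (intro mult_right_mono) auto
  also have "\<dots> = 1" by (simp add: exp_minus_inverse mult.commute)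
  finally show ?thesis using True by (simp add: algebra_simps)
next
  case False
  have "1 - exp s \<le> - s" using exp_ge_add_one_self[of s] by linarith
  also have "\<dots> \<le> - s * exp (- s)" using False by (simp add: mult_le_cancel_left1)
  finally show ?thesis using False by (simp add: abs_if)
qed

lemma integral_normal_vec:
  fixes f :: "real^'n \<Rightarrow> real"
  assumes "pos_def_mat S" "f \<in> borel_measurable borel"
  shows "(\<integral>x. f x \<partial>normal_vec S) = (\<integral>x. mvn_density S x * f x \<partial>lborel)"
  using assms unfolding normal_vec_def by (subst integral_density) auto

text \<open>Both sides are the derivative at \<open>t = 0\<close> of the expectation of \<open>k (x + t *\<^sub>R v)\<close>, where
  \<open>v = S *v a\<close>: on the right the translation has been moved to the density.\<close>
lemma stein_directional:
  fixes S :: "real^'n^'n" and k k' :: "real^'n \<Rightarrow> real"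
  assumes S: "pos_def_mat S"
    and [measurable]: "k \<in> borel_measurable borel" "k' \<in> borel_measurable borel"
    and K: "\<And>x. \<bar>k x\<bar> \<le> K" and K': "\<And>x. \<bar>k' x\<bar> \<le> K'"
    and deriv: "\<And>x t. ((\<lambda>t. k (x + t *\<^sub>R (S *v a))) has_real_derivative k' (x + t *\<^sub>R (S *v a))) (at t)"
  shows "(\<integral>x. k' x \<partial>normal_vec S) = (\<integral>x. k x * (a \<bullet> x) \<partial>normal_vec S)"
proof -
  define v where "v = S *v a"
  define q where "q = a \<bullet> v"
  \<comment> \<open>A sequence of steps in \<open>(0, 1]\<close> tending to 0, since dominated
    convergence is applied along sequences.\<close>
  define t where "t n = inverse (real (Suc n))" for n
  let ?\<phi> = "mvn_density S"
  have t0: "t n > 0" and t1: "t n \<le> 1" for n by (simp_all add: t_def field_simps)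
  have tlim: "filterlim t (at 0) sequentially"
    using LIMSEQ_inverse_real_of_nat t0 unfolding t_def[abs_def] filterlim_at by auto
  have K0: "K \<ge> 0" using K[of 0] by linarith
  \<comment> \<open>Difference quotients of the same function of \<open>t\<close>, in
    \<open>u\<close> taken on \<open>k\<close> and in \<open>w\<close> on the density; their limits
    give the two sides of the identity.\<close>
  define u where "u n x = ?\<phi> x * ((k (x + t n *\<^sub>R v) - k x) / t n)" for n x
  define w where "w n x = k x * (?\<phi> x * ((exp (t n * (a \<bullet> x) - (t n)\<^sup>2 * q / 2) - 1) / t n))" for n x
  have lim_u: "(\<lambda>n. \<integral>x. u n x \<partial>lborel) \<longlonglongrightarrow> (\<integral>x. ?\<phi> x * k' x \<partial>lborel)"
  proof (rule integral_dominated_convergence)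
    show "integrable lborel (\<lambda>x. K' * ?\<phi> x)" by (intro integrable_mult_right integrable_mvn_density S)
    show "AE x in lborel. (\<lambda>n. u n x) \<longlonglongrightarrow> ?\<phi> x * k' x"
    proof (rule AE_I2)
      fix x
      have "((\<lambda>h. (k (x + h *\<^sub>R v) - k x) / h) \<longlongrightarrow> k' x) (at 0)"
        using deriv[of x 0] unfolding v_def[symmetric] DERIV_def by simp
      then have "(\<lambda>n. (k (x + t n *\<^sub>R v) - k x) / t n) \<longlonglongrightarrow> k' x"
        by (rule filterlim_compose[OF _ tlim])
      then show "(\<lambda>n. u n x) \<longlonglongrightarrow> ?\<phi> x * k' x" unfolding u_def by (intro tendsto_intros)
    qed
    show "AE x in lborel. norm (u n x) \<le> K' * ?\<phi> x" for n
    proof (rule AE_I2)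
      fix x
      obtain z where "k (x + t n *\<^sub>R v) - k (x + 0 *\<^sub>R v) = (t n - 0) * k' (x + z *\<^sub>R v)"
        using MVT2[OF t0[of n], of "\<lambda>s. k (x + s *\<^sub>R v)" "\<lambda>s. k' (x + s *\<^sub>R v)"] deriv[of x]
        unfolding v_def[symmetric] by blast
      then have "(k (x + t n *\<^sub>R v) - k x) / t n = k' (x + z *\<^sub>R v)"
        using t0[of n] by simp
      then have "norm (u n x) = ?\<phi> x * \<bar>k' (x + z *\<^sub>R v)\<bar>" using S by (simp add: u_def abs_mult)
      also have "\<dots> \<le> ?\<phi> x * K'" using S K' by (intro mult_left_mono) auto
      finally show "norm (u n x) \<le> K' * ?\<phi> x" by (simp add: mult.commute)
    qed
  qed (simp_all add: u_def)
  have lim_w: "(\<lambda>n. \<integral>x. w n x \<partial>lborel) \<longlonglongrightarrow> (\<integral>x. k x * (?\<phi> x * (a \<bullet> x)) \<partial>lborel)"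
  proof (rule integral_dominated_convergence)
    \<comment> \<open>With \<open>m = \<bar>a \<bullet> x\<bar> + \<bar>q\<bar>\<close> the quotient
      is at most \<open>m * exp m\<close>, hence at most \<open>exp (2 * m)\<close>. The absolute
      value of \<open>a \<bullet> x\<close> in the exponent is then removed by adding the
      exponentials of both signs, which have integrals by
      \<open>integrable_mvn_density_exp\<close>.\<close>
    let ?B = "\<lambda>x. K * exp (2 * \<bar>q\<bar>) * (?\<phi> x * exp (2 * (a \<bullet> x)) + ?\<phi> x * exp ((-2) * (a \<bullet> x)))"
    show "integrable lborel ?B"
      by (intro integrable_mult_right Bochner_Integration.integrable_add integrable_mvn_density_exp S)
    show "AE x in lborel. (\<lambda>n. w n x) \<longlonglongrightarrow> k x * (?\<phi> x * (a \<bullet> x))"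
    proof (rule AE_I2)
      fix x
      have "((\<lambda>h. exp (h * (a \<bullet> x) - h\<^sup>2 * q / 2)) has_real_derivative a \<bullet> x) (at 0)"
        by (auto intro!: derivative_eq_intros)
      then have "((\<lambda>h. (exp (h * (a \<bullet> x) - h\<^sup>2 * q / 2) - 1) / h) \<longlongrightarrow> a \<bullet> x) (at 0)"
        unfolding DERIV_def by simp
      then have "(\<lambda>n. (exp (t n * (a \<bullet> x) - (t n)\<^sup>2 * q / 2) - 1) / t n) \<longlonglongrightarrow> a \<bullet> x"
        by (rule filterlim_compose[OF _ tlim])
      then show "(\<lambda>n. w n x) \<longlonglongrightarrow> k x * (?\<phi> x * (a \<bullet> x))" unfolding w_def by (intro tendsto_intros)
    qed
    show "AE x in lborel. norm (w n x) \<le> ?B x" for n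
    proof (rule AE_I2)
      fix x
      define s where "s = t n * (a \<bullet> x) - (t n)\<^sup>2 * q / 2"
      define m where "m = \<bar>a \<bullet> x\<bar> + \<bar>q\<bar>"
      have "s = t n * (a \<bullet> x - t n * q / 2)" by (simp add: s_def power2_eq_square algebra_simps)
      then have "\<bar>s\<bar> = t n * \<bar>a \<bullet> x - t n * q / 2\<bar>" using t0[of n] by (simp add: abs_mult)
      moreover have "\<bar>t n * q / 2\<bar> \<le> \<bar>q\<bar>"
        using mult_mono[OF t1[of n] order_refl, of "\<bar>q\<bar>"] t0[of n] by (simp add: abs_mult)
      then have "\<bar>a \<bullet> x - t n * q / 2\<bar> \<le> m" unfolding m_def by linarith
      ultimately have s1: "\<bar>s\<bar> \<le> t n * m" using t0[of n] by simp
      have m0: "m \<ge> 0" by (simp add: m_def)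
      have s2: "\<bar>s\<bar> \<le> m" using s1 mult_right_mono[OF t1[of n] m0] by linarith
      have "\<bar>exp s - 1\<bar> \<le> \<bar>s\<bar> * exp \<bar>s\<bar>" by (rule abs_exp_minus_one_le)
      also have "\<dots> \<le> (t n * m) * exp m" using s1 s2 by (intro mult_mono) auto
      finally have "\<bar>exp s - 1\<bar> / t n \<le> m * exp m" using t0[of n] by (simp add: field_simps)
      also have "\<dots> \<le> exp m * exp m" using exp_ge_add_one_self[of m] by (intro mult_right_mono) (linarith, simp)
      also have "\<dots> = exp (2 * \<bar>q\<bar>) * exp (2 * \<bar>a \<bullet> x\<bar>)" by (simp add: m_def exp_add[symmetric])
      also have "\<dots> \<le> exp (2 * \<bar>q\<bar>) * (exp (2 * (a \<bullet> x)) + exp ((-2) * (a \<bullet> x)))"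
        by (intro mult_left_mono) (auto simp: abs_if)
      finally have e: "\<bar>exp s - 1\<bar> / t n \<le> exp (2 * \<bar>q\<bar>) * (exp (2 * (a \<bullet> x)) + exp ((-2) * (a \<bullet> x)))" .
      have "norm (w n x) = \<bar>k x\<bar> * (?\<phi> x * (\<bar>exp s - 1\<bar> / t n))"
        using S t0[of n] by (simp add: w_def s_def[symmetric] abs_mult)
      also have "\<dots> \<le> K * (?\<phi> x * (exp (2 * \<bar>q\<bar>) * (exp (2 * (a \<bullet> x)) + exp ((-2) * (a \<bullet> x)))))"
        using S t0[of n] by (intro mult_mono[OF K] mult_left_mono[OF e] mult_nonneg_nonneg K0) auto
      finally show "norm (w n x) \<le> ?B x" by (simp add: algebra_simps)
    qed
  qed (simp_all add: w_def)
  have int_k: "integrable lborel (\<lambda>x. k x * ?\<phi> x)"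
    by (rule Bochner_Integration.integrable_bound[OF integrable_mult_right[OF integrable_mvn_density[OF S], of K]])
       (use S K K0 in \<open>auto simp: abs_mult intro!: mult_right_mono\<close>)
  have "(\<integral>x. u n x \<partial>lborel) = (\<integral>x. w n x \<partial>lborel)" for n
  proof -
    let ?e = "\<lambda>x. exp (t n * (a \<bullet> x) - (t n)\<^sup>2 * q / 2)"
    let ?F = "\<lambda>x. k x * ?\<phi> (- (t n *\<^sub>R v) + x)"
    have shift: "?\<phi> (- (t n *\<^sub>R v) + x) = ?\<phi> x * ?e x" for x
      using mvn_density_shift[OF S, of x "t n" a] by (simp add: v_def q_def)
    have eq: "?F (t n *\<^sub>R v + x) = k (x + t n *\<^sub>R v) * ?\<phi> x" for x by (simp add: add.commute)
    have int1: "integrable lborel (\<lambda>x. k (x + t n *\<^sub>R v) * ?\<phi> x)"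
      by (rule Bochner_Integration.integrable_bound[OF integrable_mult_right[OF integrable_mvn_density[OF S], of K]])
         (use S K K0 in \<open>auto simp: abs_mult intro!: mult_right_mono\<close>)
    then have int2: "integrable lborel ?F"
      by (subst integrable_lborel_translate_iff[of ?F "t n *\<^sub>R v", symmetric]) (simp_all only: eq, measurable)
    have int3: "(\<integral>x. k (x + t n *\<^sub>R v) * ?\<phi> x \<partial>lborel) = (\<integral>x. ?F x \<partial>lborel)"
      by (subst integral_lborel_translate[of ?F "t n *\<^sub>R v", symmetric]) (simp_all only: eq, measurable)
    have "(\<integral>x. u n x \<partial>lborel) = (\<integral>x. (k (x + t n *\<^sub>R v) * ?\<phi> x - k x * ?\<phi> x) / t n \<partial>lborel)"
      by (intro Bochner_Integration.integral_cong) (simp_all add: u_def field_simps)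
    also have "\<dots> = ((\<integral>x. ?F x \<partial>lborel) - (\<integral>x. k x * ?\<phi> x \<partial>lborel)) / t n"
      by (simp add: Bochner_Integration.integral_diff[OF int1 int_k] int3)
    also have "\<dots> = (\<integral>x. (?F x - k x * ?\<phi> x) / t n \<partial>lborel)"
      by (simp only: integral_divide_zero Bochner_Integration.integral_diff[OF int2 int_k])
    also have "\<dots> = (\<integral>x. w n x \<partial>lborel)"
      by (intro Bochner_Integration.integral_cong) (simp_all only: w_def shift, simp_all add: field_simps)
    finally show ?thesis .
  qed
  then have "(\<integral>x. ?\<phi> x * k' x \<partial>lborel) = (\<integral>x. k x * (?\<phi> x * (a \<bullet> x)) \<partial>lborel)"
    using lim_u lim_w LIMSEQ_unique by simp
  then show ?thesis by (simp add: integral_normal_vec[OF S] mult.left_commute)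
qed

text \<open>Averaged over the covariance, this turns a bound on the mean of
  \<open>lambda_max\<close> into a finite second moment of the noise.\<close>

lemma nn_integral_normal_vec_norm_sq_le:
  fixes S :: "real^'n^'n"
  assumes S: "pos_def_mat S"
  shows "(\<integral>\<^sup>+x. ennreal ((norm x)\<^sup>2) \<partial>normal_vec S)
    \<le> ennreal (lambda_max S) * (\<integral>\<^sup>+y. ennreal ((norm y)\<^sup>2) \<partial>normal_vec (mat 1 :: real^'n^'n))"
proof -
  obtain A :: "real^'n^'n" where A: "normal_vec S = distr (normal_vec (mat 1)) borel ((*v) A)"
    "\<And>y. norm (A *v y) \<le> sqrt (lambda_max S) * norm y"
    using normal_vec_sqrt[OF S] by blast
  have pos: "lambda_max S > 0" by (rule lambda_max_pos[OF S])
  have "(\<integral>\<^sup>+x. ennreal ((norm x)\<^sup>2) \<partial>normal_vec S) = (\<integral>\<^sup>+y. ennreal ((norm (A *v y))\<^sup>2) \<partial>normal_vec (mat 1))"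
    unfolding A(1) by (simp add: nn_integral_distr)
  also have "\<dots> \<le> (\<integral>\<^sup>+y. ennreal (lambda_max S) * ennreal ((norm y)\<^sup>2) \<partial>normal_vec (mat 1 :: real^'n^'n))"
  proof (intro nn_integral_mono)
    fix y
    have "(norm (A *v y))\<^sup>2 \<le> (sqrt (lambda_max S) * norm y)\<^sup>2" using A(2) by (intro power_mono) auto
    also have "\<dots> = lambda_max S * (norm y)\<^sup>2" using pos by (simp add: power_mult_distrib)
    finally show "ennreal ((norm (A *v y))\<^sup>2) \<le> ennreal (lambda_max S) * ennreal ((norm y)\<^sup>2)"
      using pos by (subst ennreal_mult[symmetric]) (auto intro: ennreal_leI)
  qed
  also have "\<dots> = ennreal (lambda_max S) * (\<integral>\<^sup>+y. ennreal ((norm y)\<^sup>2) \<partial>normal_vec (mat 1 :: real^'n^'n))"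
    by (simp add: nn_integral_cmult)
  finally show ?thesis .
qed

lemma integrable_normal_vec_norm:
  fixes S :: "real^'n^'n"
  assumes S: "pos_def_mat S"
  shows "integrable (normal_vec S) norm"
proof -
  interpret prob_space "normal_vec S" by (rule prob_space_normal_vec[OF S])
  have "integrable (normal_vec S) (\<lambda>x. (norm x)\<^sup>2)"
  proof (rule integrableI_nonneg)
    show "(\<integral>\<^sup>+x. ennreal ((norm x)\<^sup>2) \<partial>normal_vec S) < \<infinity>"
      by (rule le_less_trans[OF nn_integral_normal_vec_norm_sq_le[OF S]])
         (use nn_integral_std_normal_norm_sq[where 'n='n] in \<open>simp add: ennreal_mult_less_top\<close>)
  qed auto
  then show ?thesis by (rule square_integrable_imp_integrable[rotated]) measurable
qed

text \<open>The trace bound in homogeneous form. Nonnegativity of the coefficient allows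
  \<open>y \<bullet> y\<close> to be enlarged to the smoothed
  \<open>y \<bullet> y + e\<^sup>2\<close>.\<close>

lemma rayleigh_le_trace:
  fixes S :: "real^'n^'n"
  assumes S: "pos_def_mat S" and lam: "lam \<le> lambda_min S"
  shows "0 \<le> trace S - (real CARD('n) - 1) * lam"
    and "y \<bullet> (S *v y) \<le> (trace S - (real CARD('n) - 1) * lam) * (y \<bullet> y)"
proof -
  have sym: "transpose S = S" and pos: "\<And>x. x \<noteq> 0 \<Longrightarrow> x \<bullet> (S *v x) > 0"
    using S by (auto simp: pos_def_mat_def)
  have *: "u \<bullet> (S *v u) \<le> trace S - (real CARD('n) - 1) * lam" if "norm u = 1" for u
    using trace_minus_rayleigh_ge[OF sym lam that] by simp
  obtain k :: 'n where True by simp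
  show "0 \<le> trace S - (real CARD('n) - 1) * lam"
    using *[of "axis k 1"] pos[of "axis k 1"] by simp
  show "y \<bullet> (S *v y) \<le> (trace S - (real CARD('n) - 1) * lam) * (y \<bullet> y)"
  proof (cases "y = 0")
    case False
    then have "(y /\<^sub>R norm y) \<bullet> (S *v (y /\<^sub>R norm y)) \<le> trace S - (real CARD('n) - 1) * lam"
      by (intro *) simp
    then have "(y \<bullet> (S *v y)) / (norm y)\<^sup>2 \<le> trace S - (real CARD('n) - 1) * lam"
      by (simp add: matrix_vector_mult_scaleR power2_eq_square divide_inverse mult_ac)
    then show ?thesis using False by (simp add: pos_divide_le_eq dot_square_norm)
  qed simp
qed

section \<open>Smoothing of the field \<open>y / norm y\<close>\<close>

lemma norm_le_smoothed_norm: "norm y \<le> sqrt (y \<bullet> y + e\<^sup>2)"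
  by (rule real_le_rsqrt) (simp add: power2_norm_eq_inner)

text \<open>As \<open>e > 0\<close>, the smoothed norm never vanishes and the quotient rule holds at
  every point, the origin included.\<close>

lemma has_real_derivative_smoothed_direction:
  fixes y v b :: "'a::real_inner"
  assumes "e > 0"
  defines "\<rho> \<equiv> \<lambda>z. sqrt (z \<bullet> z + e\<^sup>2)"
  shows "((\<lambda>t. ((y + t *\<^sub>R v) \<bullet> b) / \<rho> (y + t *\<^sub>R v)) has_real_derivative
    (v \<bullet> b) / \<rho> (y + t *\<^sub>R v) - ((y + t *\<^sub>R v) \<bullet> b) * ((y + t *\<^sub>R v) \<bullet> v) / \<rho> (y + t *\<^sub>R v) ^ 3) (at t)"
proof -
  define z where "z = y + t *\<^sub>R v"
  have pos: "z \<bullet> z + e\<^sup>2 > 0" using assms(1) by (simp add: add_nonneg_pos)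
  have r: "\<rho> z > 0" using pos by (simp add: \<rho>_def)
  have r2: "\<rho> z ^ 2 = z \<bullet> z + e\<^sup>2" using pos by (simp add: \<rho>_def)
  have d1: "((\<lambda>t. (y + t *\<^sub>R v) \<bullet> b) has_real_derivative v \<bullet> b) (at t)"
    by (auto simp: inner_add_left intro!: derivative_eq_intros)
  have "((\<lambda>t. y \<bullet> y + 2 * t * (y \<bullet> v) + t\<^sup>2 * (v \<bullet> v) + e\<^sup>2) has_real_derivative 2 * (z \<bullet> v)) (at t)"
    by (auto simp: z_def inner_add_left algebra_simps intro!: derivative_eq_intros)
  moreover have "y \<bullet> y + 2 * t * (y \<bullet> v) + t\<^sup>2 * (v \<bullet> v) + e\<^sup>2 = (y + t *\<^sub>R v) \<bullet> (y + t *\<^sub>R v) + e\<^sup>2" for t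
    by (simp add: inner_add inner_commute[of v y] power2_eq_square algebra_simps)
  ultimately have d2: "((\<lambda>t. (y + t *\<^sub>R v) \<bullet> (y + t *\<^sub>R v) + e\<^sup>2) has_real_derivative 2 * (z \<bullet> v)) (at t)"
    by simp
  have d3: "((\<lambda>t. \<rho> (y + t *\<^sub>R v)) has_real_derivative (z \<bullet> v) / \<rho> z) (at t)"
    using DERIV_chain2[OF DERIV_real_sqrt[OF pos[unfolded z_def]] d2]
    by (simp add: \<rho>_def z_def field_simps)
  have "((\<lambda>t. ((y + t *\<^sub>R v) \<bullet> b) / \<rho> (y + t *\<^sub>R v)) has_real_derivative
      ((v \<bullet> b) * \<rho> z - (z \<bullet> b) * ((z \<bullet> v) / \<rho> z)) / (\<rho> z * \<rho> z)) (at t)"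
    using DERIV_divide[OF d1 d3] r by (simp add: z_def)
  also have "((v \<bullet> b) * \<rho> z - (z \<bullet> b) * ((z \<bullet> v) / \<rho> z)) / (\<rho> z * \<rho> z)
      = (v \<bullet> b) / \<rho> z - (z \<bullet> b) * (z \<bullet> v) / \<rho> z ^ 3"
    using r by (simp add: field_simps power3_eq_cube)
  finally show ?thesis by (simp add: z_def)
qed

text \<open>Apply \<open>stein_directional\<close> to each coordinate of
  \<open>z / \<rho> z\<close>, with \<open>a\<close> the matching basis vector, and add up. The
  derivatives sum to \<open>trace S / \<rho> z - (z \<bullet> (S *v z)) / \<rho> z ^ 3\<close>;
  since \<open>z \<bullet> z \<le> \<rho> z ^ 2\<close>, the trace bound survives the
  smoothing.\<close>

lemma stein_smoothed:
  fixes S :: "real^'n^'n"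
  assumes S: "pos_def_mat S" and lam: "lam \<le> lambda_min S" and e: "e > 0"
  defines "\<rho> \<equiv> \<lambda>z::real^'n. sqrt (z \<bullet> z + e\<^sup>2)"
  shows "(real CARD('n) - 1) * lam * (\<integral>x. 1 / \<rho> (\<theta> + x) \<partial>normal_vec S)
    \<le> (\<integral>x. (x \<bullet> (\<theta> + x)) / \<rho> (\<theta> + x) \<partial>normal_vec S)"
proof -
  interpret prob_space "normal_vec S" by (rule prob_space_normal_vec[OF S])
  define a where "a i = (axis i 1 :: real^'n)" for i
  define k where "k i x = ((\<theta> + x) \<bullet> a i) / \<rho> (\<theta> + x)" for i x
  define k' where "k' i x = ((S *v a i) \<bullet> a i) / \<rho> (\<theta> + x)
    - ((\<theta> + x) \<bullet> a i) * ((\<theta> + x) \<bullet> (S *v a i)) / \<rho> (\<theta> + x) ^ 3" for i x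
  have [measurable]: "\<rho> \<in> borel_measurable borel" unfolding \<rho>_def by measurable
  have [measurable]: "k i \<in> borel_measurable borel" "k' i \<in> borel_measurable borel" for i
    unfolding k_def k'_def by measurable
  have re: "\<rho> z \<ge> e" for z
    unfolding \<rho>_def using e by (intro real_le_rsqrt) simp
  have r: "\<rho> z > 0" for z using re[of z] e by linarith
  have rn: "norm z \<le> \<rho> z" for z unfolding \<rho>_def by (rule norm_le_smoothed_norm)
  have na: "norm (a i) = 1" for i by (simp add: a_def)
  have abs_a: "\<bar>z \<bullet> a i\<bar> \<le> norm z" for z i
    using Cauchy_Schwarz_ineq2[of z "a i"] by (simp add: na)
  have kb: "\<bar>k i x\<bar> \<le> 1" for i x
    using order_trans[OF abs_a rn, of "\<theta> + x" i] r[of "\<theta> + x"] by (simp add: k_def)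
  \<comment> \<open>The bound blows up as \<open>e\<close> tends to 0; it is used only at fixed
    \<open>e\<close>, for integrability and as a hypothesis of
    \<open>stein_directional\<close>.\<close>
  have k'b: "\<bar>k' i x\<bar> \<le> 2 * norm (S *v a i) / e" for i x
  proof -
    let ?z = "\<theta> + x" and ?v = "S *v a i"
    have "\<bar>(?v \<bullet> a i) / \<rho> ?z\<bar> \<le> norm ?v / e"
      using abs_a[of ?v i] re[of ?z] e r[of ?z] by (simp add: abs_divide frac_le)
    moreover have "\<bar>(?z \<bullet> a i) * (?z \<bullet> ?v) / \<rho> ?z ^ 3\<bar> \<le> norm ?v / e"
    proof -
      have "\<bar>(?z \<bullet> a i) * (?z \<bullet> ?v)\<bar> \<le> norm ?z * (norm ?z * norm ?v)"
        unfolding abs_mult using abs_a[of ?z i] Cauchy_Schwarz_ineq2[of ?z ?v] by (intro mult_mono) auto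
      also have "\<dots> \<le> \<rho> ?z * (\<rho> ?z * norm ?v)"
        using rn[of ?z] r[of ?z] by (intro mult_mono) auto
      finally have "\<bar>(?z \<bullet> a i) * (?z \<bullet> ?v)\<bar> / \<rho> ?z ^ 3 \<le> \<rho> ?z * (\<rho> ?z * norm ?v) / \<rho> ?z ^ 3"
        using r[of ?z] by (intro divide_right_mono) auto
      also have "\<dots> = norm ?v / \<rho> ?z" using r[of ?z] by (simp add: power3_eq_cube)
      also have "\<dots> \<le> norm ?v / e" using re[of ?z] e by (intro divide_left_mono) auto
      finally show ?thesis using r[of ?z] by (simp add: abs_divide)
    qed
    ultimately show ?thesis unfolding k'_def by linarith
  qed
  have stein: "(\<integral>x. k' i x \<partial>normal_vec S) = (\<integral>x. k i x * (a i \<bullet> x) \<partial>normal_vec S)" for i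
  proof (rule stein_directional[OF S _ _ kb k'b])
    show "((\<lambda>t. k i (x + t *\<^sub>R (S *v a i))) has_real_derivative k' i (x + t *\<^sub>R (S *v a i))) (at t)" for x t
      using has_real_derivative_smoothed_direction[OF e, of "\<theta> + x" "S *v a i" "a i" t]
      unfolding k_def k'_def \<rho>_def by (simp add: add.assoc)
  qed measurable
  have int1: "integrable (normal_vec S) (k' i)" for i
    by (rule integrable_const_bound[of _ "2 * norm (S *v a i) / e"]) (use k'b in auto)
  have int2: "integrable (normal_vec S) (\<lambda>x. k i x * (a i \<bullet> x))" for i
  proof (rule Bochner_Integration.integrable_bound[OF integrable_normal_vec_norm[OF S]])
    show "AE x in normal_vec S. norm (k i x * (a i \<bullet> x)) \<le> norm (norm x)"
    proof (rule AE_I2)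
      show "norm (k i x * (a i \<bullet> x)) \<le> norm (norm x)" for x
        using mult_mono[OF kb[of i x] abs_a[of x i]] by (simp add: abs_mult inner_commute[of "a i"])
    qed
  qed measurable
  have int3: "integrable (normal_vec S) (\<lambda>x. 1 / \<rho> (\<theta> + x))"
    by (rule integrable_const_bound[of _ "1 / e"]) (use re r e in \<open>auto simp: frac_le abs_of_pos\<close>)
  have sum_k: "(\<Sum>i\<in>UNIV. k i x * (a i \<bullet> x)) = (x \<bullet> (\<theta> + x)) / \<rho> (\<theta> + x)" for x
    unfolding k_def a_def
    by (simp add: inner_axis inner_axis') (simp add: inner_vec_def[of x] sum_divide_distrib mult_ac)
  have sum_k': "(\<Sum>i\<in>UNIV. k' i x) = trace S / \<rho> (\<theta> + x) - ((\<theta> + x) \<bullet> (S *v (\<theta> + x))) / \<rho> (\<theta> + x) ^ 3" for x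
  proof -
    have "(S *v a i) \<bullet> a i = S $ i $ i" for i
      by (simp add: a_def inner_axis matrix_vector_mult_basis column_def)
    moreover have "(\<Sum>i\<in>UNIV. ((\<theta> + x) \<bullet> a i) * ((\<theta> + x) \<bullet> (S *v a i))) = (\<theta> + x) \<bullet> (S *v (\<theta> + x))"
      unfolding pos_def_mat_selfadjoint[OF S, symmetric] a_def
      by (simp add: inner_axis) (simp add: inner_vec_def mult.commute)
    ultimately show ?thesis
      by (simp add: k'_def sum_subtractf sum_divide_distrib[symmetric] trace_def)
  qed
  have "(real CARD('n) - 1) * lam * (\<integral>x. 1 / \<rho> (\<theta> + x) \<partial>normal_vec S)
      = (\<integral>x. (real CARD('n) - 1) * lam * (1 / \<rho> (\<theta> + x)) \<partial>normal_vec S)"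
    by (rule integral_mult_right_zero[symmetric])
  also have "\<dots> \<le> (\<integral>x. (\<Sum>i\<in>UNIV. k' i x) \<partial>normal_vec S)"
  proof (rule integral_mono)
    show "integrable (normal_vec S) (\<lambda>x. (real CARD('n) - 1) * lam * (1 / \<rho> (\<theta> + x)))"
      by (intro integrable_mult_right int3)
    show "integrable (normal_vec S) (\<lambda>x. \<Sum>i\<in>UNIV. k' i x)"
      by (intro Bochner_Integration.integrable_sum int1)
    fix x
    let ?z = "\<theta> + x" and ?T = "trace S - (real CARD('n) - 1) * lam"
    have "?z \<bullet> (S *v ?z) \<le> ?T * (?z \<bullet> ?z)" by (rule rayleigh_le_trace(2)[OF S lam])
    also have "\<dots> \<le> ?T * \<rho> ?z ^ 2"
      using rayleigh_le_trace(1)[OF S lam] by (intro mult_left_mono) (simp_all add: \<rho>_def)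
    finally have "(?z \<bullet> (S *v ?z)) / \<rho> ?z ^ 3 \<le> ?T * \<rho> ?z ^ 2 / \<rho> ?z ^ 3"
      using r[of ?z] by (intro divide_right_mono) auto
    also have "\<dots> = trace S / \<rho> ?z - (real CARD('n) - 1) * lam * (1 / \<rho> ?z)"
      using r[of ?z] by (simp add: field_simps power2_eq_square power3_eq_cube)
    finally show "(real CARD('n) - 1) * lam * (1 / \<rho> ?z) \<le> (\<Sum>i\<in>UNIV. k' i x)"
      by (simp add: sum_k')
  qed
  also have "\<dots> = (\<Sum>i\<in>UNIV. \<integral>x. k i x * (a i \<bullet> x) \<partial>normal_vec S)"
    by (subst Bochner_Integration.integral_sum) (simp_all add: int1 stein)
  also have "\<dots> = (\<integral>x. (\<Sum>i\<in>UNIV. k i x * (a i \<bullet> x)) \<partial>normal_vec S)"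
    by (subst Bochner_Integration.integral_sum) (simp_all add: int2)
  also have "\<dots> = (\<integral>x. (x \<bullet> (\<theta> + x)) / \<rho> (\<theta> + x) \<partial>normal_vec S)" by (simp add: sum_k)
  finally show ?thesis .
qed

text \<open>The smoothing parameter tends to 0. On the left the smoothed norm is first replaced by
  the larger \<open>d + e n + norm x\<close>, so the limit is dominated by the constant
  \<open>1 / d\<close> and the singular function \<open>1 / norm (\<theta> + x)\<close> never has to
  be integrated.\<close>

lemma stein_normal_vec:
  fixes S :: "real^'n^'n"
  assumes S: "pos_def_mat S" and lam: "0 \<le> lam" "lam \<le> lambda_min S" and d: "norm \<theta> \<le> d" "d > 0"
  shows "(real CARD('n) - 1) * lam * (\<integral>x. 1 / (d + norm x) \<partial>normal_vec S)
    \<le> (\<integral>x. (x \<bullet> (\<theta> + x)) / norm (\<theta> + x) \<partial>normal_vec S)"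
proof -
  interpret prob_space "normal_vec S" by (rule prob_space_normal_vec[OF S])
  define e where "e n = inverse (real (Suc n))" for n
  have e: "e n > 0" for n by (simp add: e_def)
  have elim: "e \<longlonglongrightarrow> 0" unfolding e_def[abs_def] by (rule LIMSEQ_inverse_real_of_nat)
  define \<rho> where "\<rho> n z = sqrt (z \<bullet> z + (e n)\<^sup>2)" for n and z :: "real^'n"
  have [measurable]: "\<rho> n \<in> borel_measurable borel" for n unfolding \<rho>_def by measurable
  have rpos: "\<rho> n z > 0" for n z
    using e[of n] by (simp add: \<rho>_def add_nonneg_pos)
  have rn: "norm z \<le> \<rho> n z" for n z unfolding \<rho>_def by (rule norm_le_smoothed_norm)
  have rle: "\<rho> n z \<le> norm z + e n" for n z
    unfolding \<rho>_def using e[of n] by (intro real_le_lsqrt) (auto simp: power2_sum dot_square_norm)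
  have "(\<lambda>n. (real CARD('n) - 1) * lam * (\<integral>x. 1 / (d + e n + norm x) \<partial>normal_vec S))
      \<longlonglongrightarrow> (real CARD('n) - 1) * lam * (\<integral>x. 1 / (d + 0 + norm x) \<partial>normal_vec S)"
  proof (intro tendsto_mult_left integral_dominated_convergence[where w="\<lambda>_. 1 / d"])
    show "AE x in normal_vec S. (\<lambda>n. 1 / (d + e n + norm x)) \<longlonglongrightarrow> 1 / (d + 0 + norm x)"
      using d by (intro AE_I2 tendsto_intros elim) (simp add: add_pos_nonneg less_imp_neq[THEN not_sym])
    show "AE x in normal_vec S. norm (1 / (d + e n + norm x)) \<le> 1 / d" for n
      using d e[of n] by (intro AE_I2) (simp add: abs_of_pos add_pos_nonneg frac_le)
  qed auto
  moreover have "(\<lambda>n. \<integral>x. (x \<bullet> (\<theta> + x)) / \<rho> n (\<theta> + x) \<partial>normal_vec S)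
      \<longlonglongrightarrow> (\<integral>x. (x \<bullet> (\<theta> + x)) / norm (\<theta> + x) \<partial>normal_vec S)"
  proof (rule integral_dominated_convergence[where w=norm])
    show "integrable (normal_vec S) norm" by (rule integrable_normal_vec_norm[OF S])
    show "AE x in normal_vec S. (\<lambda>n. (x \<bullet> (\<theta> + x)) / \<rho> n (\<theta> + x)) \<longlonglongrightarrow> (x \<bullet> (\<theta> + x)) / norm (\<theta> + x)"
    proof (rule AE_I2)
      fix x
      show "(\<lambda>n. (x \<bullet> (\<theta> + x)) / \<rho> n (\<theta> + x)) \<longlonglongrightarrow> (x \<bullet> (\<theta> + x)) / norm (\<theta> + x)"
      \<comment> \<open>At \<open>\<theta> + x = 0\<close> the numerator vanishes, so all terms are
        0, and so is the limit, as division by 0 gives 0.\<close>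
      proof (cases "\<theta> + x = 0")
        case False
        have "(\<lambda>n. \<rho> n (\<theta> + x)) \<longlonglongrightarrow> sqrt ((\<theta> + x) \<bullet> (\<theta> + x) + 0\<^sup>2)"
          unfolding \<rho>_def by (intro tendsto_intros elim)
        then have "(\<lambda>n. \<rho> n (\<theta> + x)) \<longlonglongrightarrow> norm (\<theta> + x)" by (simp add: norm_eq_sqrt_inner)
        then show ?thesis using False by (intro tendsto_intros) auto
      qed simp
    qed
    show "AE x in normal_vec S. norm ((x \<bullet> (\<theta> + x)) / \<rho> n (\<theta> + x)) \<le> norm x" for n
    proof (rule AE_I2)
      fix x
      have "\<bar>x \<bullet> (\<theta> + x)\<bar> \<le> norm x * norm (\<theta> + x)" by (rule Cauchy_Schwarz_ineq2)
      also have "\<dots> \<le> norm x * \<rho> n (\<theta> + x)" using rn by (intro mult_left_mono) auto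
      finally show "norm ((x \<bullet> (\<theta> + x)) / \<rho> n (\<theta> + x)) \<le> norm x"
        using rpos[of n "\<theta> + x"] by (simp add: field_simps)
    qed
  qed measurable
  moreover have "(real CARD('n) - 1) * lam * (\<integral>x. 1 / (d + e n + norm x) \<partial>normal_vec S)
      \<le> (\<integral>x. (x \<bullet> (\<theta> + x)) / \<rho> n (\<theta> + x) \<partial>normal_vec S)" for n
  proof -
    have "(\<integral>x. 1 / (d + e n + norm x) \<partial>normal_vec S) \<le> (\<integral>x. 1 / \<rho> n (\<theta> + x) \<partial>normal_vec S)"
    proof (rule integral_mono)
      show "integrable (normal_vec S) (\<lambda>x. 1 / (d + e n + norm x))"
        using d e[of n] by (intro integrable_const_bound[of _ "1 / d"] AE_I2) (simp_all add: abs_of_pos add_pos_nonneg frac_le)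
      have "e n \<le> \<rho> n z" for z unfolding \<rho>_def using e[of n] by (intro real_le_rsqrt) simp
      then show "integrable (normal_vec S) (\<lambda>x. 1 / \<rho> n (\<theta> + x))"
        using e[of n] rpos[of n]
        by (intro integrable_const_bound[of _ "1 / e n"] AE_I2) (auto simp: abs_of_pos intro!: frac_le)
      show "1 / (d + e n + norm x) \<le> 1 / \<rho> n (\<theta> + x)" for x
        using rle[of n "\<theta> + x"] norm_triangle_ineq[of \<theta> x] d rpos[of n "\<theta> + x"]
        by (intro divide_left_mono) auto
    qed
    then have "(real CARD('n) - 1) * lam * (\<integral>x. 1 / (d + e n + norm x) \<partial>normal_vec S)
      \<le> (real CARD('n) - 1) * lam * (\<integral>x. 1 / \<rho> n (\<theta> + x) \<partial>normal_vec S)"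
      using lam(1) by (intro mult_left_mono mult_nonneg_nonneg) auto
    also have "\<dots> \<le> (\<integral>x. (x \<bullet> (\<theta> + x)) / \<rho> n (\<theta> + x) \<partial>normal_vec S)"
      unfolding \<rho>_def by (rule stein_smoothed[OF S lam(2) e])
    finally show ?thesis .
  qed
  ultimately show ?thesis by (auto intro: LIMSEQ_le)
qed

subsection \<open>The radial bound and the constant\<close>

text \<open>The tangent line at \<open>L = a\<close>, obtained without calculus from two
  inequalities: \<open>sqrt\<close> lies below its tangent because
  \<open>(u - w)\<^sup>2 \<ge> 0\<close>, and \<open>1 / X\<close> exceeds its tangent at
  \<open>Y\<close> by \<open>(X - Y)\<^sup>2 / (X * Y\<^sup>2)\<close>.\<close>

lemma inverse_sqrt_tangent:
  fixes d a L r :: real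
  assumes d: "d > 0" and a: "a > 0" and L: "L \<ge> 0" and r: "r \<ge> 0"
  shows "1 / (d + sqrt a * r) - r / (2 * sqrt a * (d + sqrt a * r)\<^sup>2) * (L - a) \<le> 1 / (d + sqrt L * r)"
proof -
  define u w where "u = sqrt L" and "w = sqrt a"
  have uw: "u \<ge> 0" "w > 0" "L = u\<^sup>2" "a = w\<^sup>2" using a L by (simp_all add: u_def w_def)
  define X Y where "X = d + u * r" and "Y = d + w * r"
  have XY: "X > 0" "Y > 0" using d r uw by (simp_all add: X_def Y_def add_pos_nonneg)
  have "r * (u - w) \<le> r * ((u\<^sup>2 - w\<^sup>2) / (2 * w))"
  proof (rule mult_left_mono[OF _ r])
    have "0 \<le> (u - w)\<^sup>2" by simp
    then show "u - w \<le> (u\<^sup>2 - w\<^sup>2) / (2 * w)"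
      using uw by (simp add: field_simps power2_eq_square)
  qed
  then have "(X - Y) / Y\<^sup>2 \<le> r * ((L - a) / (2 * w)) / Y\<^sup>2"
    by (intro divide_right_mono) (simp_all add: X_def Y_def uw algebra_simps)
  moreover have "1 / Y - (X - Y) / Y\<^sup>2 \<le> 1 / X"
  proof -
    have "1 / X - (1 / Y - (X - Y) / Y\<^sup>2) = (X - Y)\<^sup>2 / (X * Y\<^sup>2)"
      using XY by (simp add: field_simps power2_eq_square)
    also have "\<dots> \<ge> 0" using XY by simp
    finally show ?thesis by simp
  qed
  ultimately have "1 / Y - r * ((L - a) / (2 * w)) / Y\<^sup>2 \<le> 1 / X" by linarith
  then show ?thesis by (simp add: X_def Y_def u_def w_def)
qed

text \<open>Minus the derivative of \<open>L \<mapsto> 1 / (d + sqrt L * r)\<close> at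
  \<open>L = a\<close>.\<close>

definition tangent_slope :: "real \<Rightarrow> real \<Rightarrow> real \<Rightarrow> real" where
  "tangent_slope d a r = r / (2 * sqrt a * (d + sqrt a * r)\<^sup>2)"

text \<open>The upper bound comes from the cross term of the square in the denominator; being
  uniform in \<open>r\<close>, it makes the slope integrable.\<close>

lemma tangent_slope_bounds:
  assumes "d > 0" "a > 0" "r \<ge> 0"
  shows "0 \<le> tangent_slope d a r" "tangent_slope d a r \<le> 1 / (2 * a * d)"
proof -
  show "0 \<le> tangent_slope d a r" using assms by (simp add: tangent_slope_def)
  have pos: "d + sqrt a * r > 0" using assms by (simp add: add_pos_nonneg)
  have "r * (2 * a * d) \<le> 2 * sqrt a * (d + sqrt a * r)\<^sup>2"
  proof -
    have "2 * sqrt a * (d + sqrt a * r)\<^sup>2 = 2 * sqrt a * (d\<^sup>2 + (sqrt a * r)\<^sup>2) + 4 * d * r * (sqrt a * sqrt a)"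
      by (simp add: power2_sum algebra_simps del: real_sqrt_mult_self)
    moreover have "0 \<le> 2 * sqrt a * (d\<^sup>2 + (sqrt a * r)\<^sup>2)" "0 \<le> d * r * a"
      using assms by simp_all
    ultimately show ?thesis using assms by simp
  qed
  then show "tangent_slope d a r \<le> 1 / (2 * a * d)"
    using assms pos by (simp add: tangent_slope_def divide_simps)
qed

lemma borel_measurable_tangent_slope [measurable]: "tangent_slope d a \<in> borel_measurable borel"
  unfolding tangent_slope_def by measurable

text \<open>The tangent inequality integrated along \<open>y \<mapsto> A *v y\<close>. The
  coefficient of \<open>lambda_max S - a\<close> is independent of \<open>S\<close>, so averaging
  over \<open>S\<close> later involves only the mean of \<open>lambda_max\<close>.\<close>

lemma integral_inverse_norm_normal_vec_ge:
  fixes S :: "real^'n^'n"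
  assumes S: "pos_def_mat S" and d: "d > 0" and a: "a > 0"
  defines "N \<equiv> normal_vec (mat 1 :: real^'n^'n)"
  shows "(\<integral>y. 1 / (d + sqrt a * norm y) \<partial>N) - (\<integral>y. tangent_slope d a (norm y) \<partial>N) * (lambda_max S - a)
    \<le> (\<integral>x. 1 / (d + norm x) \<partial>normal_vec S)"
proof -
  interpret prob_space N unfolding N_def by (rule prob_space_normal_vec_std)
  have [measurable_cong]: "sets N = sets borel" by (simp add: N_def)
  obtain A :: "real^'n^'n" where A: "normal_vec S = distr N borel ((*v) A)"
    "\<And>y. norm (A *v y) \<le> sqrt (lambda_max S) * norm y"
    using normal_vec_sqrt[OF S] unfolding N_def by blast
  have L: "lambda_max S \<ge> 0" using lambda_max_pos[OF S] by simp
  have int1: "integrable N (\<lambda>y. 1 / (d + sqrt a * norm y))"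
    using d a by (intro integrable_const_bound[of _ "1 / d"] AE_I2) (simp_all add: abs_of_pos add_pos_nonneg frac_le)
  have int2: "integrable N (\<lambda>y. tangent_slope d a (norm y))"
    using tangent_slope_bounds[OF d a]
    by (intro integrable_const_bound[of _ "1 / (2 * a * d)"] AE_I2) simp_all
  have int3: "integrable N (\<lambda>y. 1 / (d + norm (A *v y)))"
    using d by (intro integrable_const_bound[of _ "1 / d"] AE_I2) (simp_all add: abs_of_pos add_pos_nonneg frac_le)
  have "(\<integral>y. 1 / (d + sqrt a * norm y) \<partial>N) - (\<integral>y. tangent_slope d a (norm y) \<partial>N) * (lambda_max S - a)
    = (\<integral>y. 1 / (d + sqrt a * norm y) - tangent_slope d a (norm y) * (lambda_max S - a) \<partial>N)"
    using int1 int2 by simp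
  also have "\<dots> \<le> (\<integral>y. 1 / (d + norm (A *v y)) \<partial>N)"
  proof (rule integral_mono)
    fix y :: "real^'n"
    have "1 / (d + sqrt a * norm y) - tangent_slope d a (norm y) * (lambda_max S - a)
        \<le> 1 / (d + sqrt (lambda_max S) * norm y)"
      unfolding tangent_slope_def by (rule inverse_sqrt_tangent[OF d a L]) simp
    also have "\<dots> \<le> 1 / (d + norm (A *v y))"
      using A(2)[of y] d by (intro divide_left_mono mult_pos_pos) (simp_all add: add_pos_nonneg L)
    finally show "1 / (d + sqrt a * norm y) - tangent_slope d a (norm y) * (lambda_max S - a)
        \<le> 1 / (d + norm (A *v y))" .
  qed (use int1 int2 int3 in auto)
  also have "\<dots> = (\<integral>x. 1 / (d + norm x) \<partial>normal_vec S)"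
    unfolding A(1) by (subst integral_distr) auto
  finally show ?thesis .
qed

section \<open>The closed form of the radial integral\<close>

lemma has_integral_I_fun:
  assumes "\<mu> > 0"
  shows "((\<lambda>r. exp (- (r\<^sup>2) / 2) / (\<mu> + r)) has_integral I_fun \<mu>) {0..}"
proof -
  have "(\<lambda>r. exp (- (r\<^sup>2) / 2) / (\<mu> + r)) integrable_on {0..}"
  proof (rule measurable_bounded_by_integrable_imp_integrable)
    show "(\<lambda>r. exp (- (r\<^sup>2) / 2) / (\<mu> + r)) \<in> borel_measurable (lebesgue_on {0..})"
      using assms by (intro continuous_imp_measurable_on_sets_lebesgue continuous_intros) auto
    show "(\<lambda>r. r ^ 0 * exp (- r\<^sup>2 / 2) / \<mu>) integrable_on {0..}"
      using has_integral_divide[OF has_integral_gaussian_moment[of 0]] by blast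
    show "norm (exp (- (r\<^sup>2) / 2) / (\<mu> + r)) \<le> r ^ 0 * exp (- r\<^sup>2 / 2) / \<mu>" if "r \<in> {0..}" for r
      using that assms by (simp add: frac_le)
  qed simp
  then show ?thesis unfolding I_fun_def by (rule integrable_integral)
qed

text \<open>Division with remainder by \<open>\<mu> + r\<close>: for \<open>m = p - 1\<close> the
  difference \<open>r ^ m - (- \<mu>) ^ m\<close> is divisible by \<open>r + \<mu>\<close>, and the
  remainder is responsible for the term with \<open>(- \<mu>) ^ p\<close>.\<close>

lemma power_over_sum:
  fixes \<mu> r :: real
  assumes "\<mu> > 0" "r \<ge> 0" "p \<ge> 2"
  shows "(\<Sum>j = 0..p - 2. (-1) ^ (p - j) * \<mu> ^ (p - 1 - j) * r ^ j) - (- \<mu>) ^ p / (\<mu> + r)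
    = \<mu> * r ^ (p - 1) / (\<mu> + r)"
proof -
  obtain m where m: "p = Suc m" "m \<ge> 1" using assms(3) by (cases p) auto
  have pos: "\<mu> + r > 0" using assms by simp
  have "{0..p - 2} = {..<m}" using m by auto
  then have "(\<Sum>j = 0..p - 2. (-1) ^ (p - j) * \<mu> ^ (p - 1 - j) * r ^ j)
      = (\<Sum>j<m. \<mu> * ((- \<mu>) ^ (m - Suc j) * r ^ j))"
  proof (rule sum.cong)
    fix j assume "j \<in> {..<m}"
    then obtain i where i: "m = Suc (j + i)" using less_imp_Suc_add by blast
    show "(-1) ^ (p - j) * \<mu> ^ (p - 1 - j) * r ^ j = \<mu> * ((- \<mu>) ^ (m - Suc j) * r ^ j)"
      by (simp add: m(1) i power_minus[of \<mu> i] Suc_diff_le)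
  qed
  also have "\<dots> = \<mu> * (\<Sum>j<m. (- \<mu>) ^ (m - Suc j) * r ^ j)" by (simp add: sum_distrib_left)
  also have "(\<Sum>j<m. (- \<mu>) ^ (m - Suc j) * r ^ j) = (r ^ m - (- \<mu>) ^ m) / (\<mu> + r)"
    using power_diff_sumr2[of r m "- \<mu>"] pos by (simp add: field_simps)
  finally show ?thesis using pos by (simp add: m(1) field_simps)
qed

text \<open>Integrate \<open>power_over_sum\<close> against the Gaussian weight: the powers of
  \<open>r\<close> give Gamma values and the pole gives \<open>I_fun \<mu>\<close>. The rescaling
  uses \<open>d + sqrt a * r = sqrt a * (\<mu> + r)\<close> and
  \<open>d = sqrt a * \<mu>\<close>.\<close>

lemma gamma_const_eq_integral:
  assumes p: "CARD('n) \<ge> 2" and d: "d > 0" and a: "a > 0"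
  shows "gamma_const CARD('n) d a = (\<integral>y. 1 / (d + sqrt a * norm y) \<partial>normal_vec (mat 1 :: real^'n^'n))"
proof -
  let ?p = "CARD('n)" let ?N = "normal_vec (mat 1 :: real^'n^'n)"
  define \<mu> where "\<mu> = d / sqrt a"
  define C where "C = 2 powr (real ?p / 2 - 1) * Gamma (real ?p / 2)"
  have \<mu>: "\<mu> > 0" using d a by (simp add: \<mu>_def)
  have C: "C > 0" using p by (simp add: C_def Gamma_real_pos)
  have "((\<lambda>r. ((\<Sum>j = 0..?p - 2. (-1) ^ (?p - j) * \<mu> ^ (?p - 1 - j) * (r ^ j * exp (- r\<^sup>2 / 2)))
        - (- \<mu>) ^ ?p * (exp (- (r\<^sup>2) / 2) / (\<mu> + r))) / (C * d)) has_integral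
      ((\<Sum>j = 0..?p - 2. (-1) ^ (?p - j) * \<mu> ^ (?p - 1 - j) * (2 powr ((real j - 1) / 2) * Gamma ((real j + 1) / 2)))
        - (- \<mu>) ^ ?p * I_fun \<mu>) / (C * d)) {0..}"
    by (intro has_integral_divide has_integral_diff has_integral_sum has_integral_mult_right
        has_integral_gaussian_moment has_integral_I_fun \<mu>) simp
  also have "((\<Sum>j = 0..?p - 2. (-1) ^ (?p - j) * \<mu> ^ (?p - 1 - j) * (2 powr ((real j - 1) / 2) * Gamma ((real j + 1) / 2)))
        - (- \<mu>) ^ ?p * I_fun \<mu>) / (C * d) = gamma_const ?p d a"
    by (simp add: gamma_const_def Let_def \<mu>_def C_def mult_ac)
  finally have I: "((\<lambda>r. r ^ (?p - 1) * exp (- r\<^sup>2 / 2) / C * (1 / (d + sqrt a * r))) has_integral gamma_const ?p d a) {0..}"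
  proof (rule has_integral_eq[rotated])
    fix r :: real assume r: "r \<in> {0..}"
    have "((\<Sum>j = 0..?p - 2. (-1) ^ (?p - j) * \<mu> ^ (?p - 1 - j) * (r ^ j * exp (- r\<^sup>2 / 2)))
        - (- \<mu>) ^ ?p * (exp (- (r\<^sup>2) / 2) / (\<mu> + r)))
      = ((\<Sum>j = 0..?p - 2. (-1) ^ (?p - j) * \<mu> ^ (?p - 1 - j) * r ^ j) - (- \<mu>) ^ ?p / (\<mu> + r)) * exp (- r\<^sup>2 / 2)"
      by (simp add: left_diff_distrib sum_distrib_right mult.assoc)
    also have "\<dots> = \<mu> * r ^ (?p - 1) / (\<mu> + r) * exp (- r\<^sup>2 / 2)"
      using r p \<mu> by (simp only: power_over_sum atLeast_iff)
    finally have *: "((\<Sum>j = 0..?p - 2. (-1) ^ (?p - j) * \<mu> ^ (?p - 1 - j) * (r ^ j * exp (- r\<^sup>2 / 2)))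
        - (- \<mu>) ^ ?p * (exp (- (r\<^sup>2) / 2) / (\<mu> + r))) = \<mu> * r ^ (?p - 1) / (\<mu> + r) * exp (- r\<^sup>2 / 2)" .
    have cancel: "\<mu> * R / m * E / (C * (s * \<mu>)) = R * E / C * (1 / (s * m))" for R E m s :: real
      using \<mu> by simp
    have "d + sqrt a * r = sqrt a * (\<mu> + r)" using a by (simp add: \<mu>_def field_simps)
    moreover have "d = sqrt a * \<mu>" using a by (simp add: \<mu>_def)
    moreover have "\<mu> + r > 0" using \<mu> r by simp
    ultimately show "((\<Sum>j = 0..?p - 2. (-1) ^ (?p - j) * \<mu> ^ (?p - 1 - j) * (r ^ j * exp (- r\<^sup>2 / 2)))
        - (- \<mu>) ^ ?p * (exp (- (r\<^sup>2) / 2) / (\<mu> + r))) / (C * d)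
      = r ^ (?p - 1) * exp (- r\<^sup>2 / 2) / C * (1 / (d + sqrt a * r))"
      unfolding * using \<mu> C a by (metis cancel)
  qed
  have nonneg: "0 \<le> r ^ (?p - 1) * exp (- r\<^sup>2 / 2) / C * (1 / (d + sqrt a * r))" if "r \<in> {0..}" for r
    using that C d a by simp
  have "(\<integral>\<^sup>+y. ennreal (1 / (d + sqrt a * norm y)) \<partial>?N)
      = (\<integral>\<^sup>+r. ennreal (r ^ (?p - 1) * exp (- r\<^sup>2 / 2) / C) * ennreal (1 / (d + sqrt a * r)) * indicator {0..} r \<partial>lborel)"
    unfolding C_def by (rule nn_integral_std_normal_radial[of "\<lambda>r. ennreal (1 / (d + sqrt a * r))"]) measurable
  also have "\<dots> = (\<integral>\<^sup>+r. ennreal (r ^ (?p - 1) * exp (- r\<^sup>2 / 2) / C * (1 / (d + sqrt a * r))) * indicator {0..} r \<partial>lborel)"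
  proof (intro nn_integral_cong)
    fix r :: real
    have "r \<ge> 0 \<Longrightarrow> ennreal (r ^ (?p - 1) * exp (- r\<^sup>2 / 2) / C) * ennreal (1 / (d + sqrt a * r))
      = ennreal (r ^ (?p - 1) * exp (- r\<^sup>2 / 2) / C * (1 / (d + sqrt a * r)))"
      using C d a by (intro ennreal_mult[symmetric]) auto
    then show "ennreal (r ^ (?p - 1) * exp (- r\<^sup>2 / 2) / C) * ennreal (1 / (d + sqrt a * r)) * indicator {0..} r
      = ennreal (r ^ (?p - 1) * exp (- r\<^sup>2 / 2) / C * (1 / (d + sqrt a * r))) * indicator {0..} r"
      by (simp add: indicator_def)
  qed
  also have "\<dots> = ennreal (gamma_const ?p d a)"
    by (rule nn_integral_has_integral_lebesgue'[OF nonneg I])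
  finally have nn: "(\<integral>\<^sup>+y. ennreal (1 / (d + sqrt a * norm y)) \<partial>?N) = ennreal (gamma_const ?p d a)" .
  have "gamma_const ?p d a \<ge> 0" using has_integral_nonneg[OF I nonneg] .
  moreover have "(\<integral>y. 1 / (d + sqrt a * norm y) \<partial>?N) = enn2real (\<integral>\<^sup>+y. ennreal (1 / (d + sqrt a * norm y)) \<partial>?N)"
    using d a by (intro integral_eq_nn_integral) auto
  ultimately show ?thesis by (simp add: nn)
qed

text \<open>The whole argument for a frozen covariance. The correction is kept affine in
  \<open>lambda_max S\<close>: it has no sign for an individual \<open>S\<close> and is disposed of
  only on averaging.\<close>

lemma normal_vec_shrinkage_bound:
  fixes S :: "real^'n^'n"
  assumes p: "CARD('n) \<ge> 2" and S: "pos_def_mat S" and lam: "0 \<le> lam" "lam \<le> lambda_min S"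
    and d: "norm \<theta> \<le> d" "d > 0" and a: "a > 0"
  defines "\<kappa> \<equiv> (\<integral>y. tangent_slope d a (norm y) \<partial>normal_vec (mat 1 :: real^'n^'n))"
  shows "(real CARD('n) - 1) * lam * gamma_const CARD('n) d a
    \<le> (\<integral>x. (x \<bullet> (\<theta> + x)) / norm (\<theta> + x) \<partial>normal_vec S) + (real CARD('n) - 1) * lam * \<kappa> * (lambda_max S - a)"
proof -
  have "gamma_const CARD('n) d a - \<kappa> * (lambda_max S - a) \<le> (\<integral>x. 1 / (d + norm x) \<partial>normal_vec S)"
    using integral_inverse_norm_normal_vec_ge[OF S d(2) a] gamma_const_eq_integral[OF p d(2) a]
    by (simp add: \<kappa>_def)
  then have "(real CARD('n) - 1) * lam * (gamma_const CARD('n) d a - \<kappa> * (lambda_max S - a))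
      \<le> (real CARD('n) - 1) * lam * (\<integral>x. 1 / (d + norm x) \<partial>normal_vec S)"
    using lam(1) p by (intro mult_left_mono) auto
  also have "\<dots> \<le> (\<integral>x. (x \<bullet> (\<theta> + x)) / norm (\<theta> + x) \<partial>normal_vec S)"
    by (rule stein_normal_vec[OF S lam d])
  finally show ?thesis by (simp add: algebra_simps)
qed

subsection \<open>Normal mixtures\<close>

lemma borel_measurable_vec_nth_nth:
  fixes A :: "'a \<Rightarrow> real^'n^'m"
  assumes "A \<in> borel_measurable M"
  shows "(\<lambda>\<omega>. A \<omega> $ i $ j) \<in> borel_measurable M"
  using assms by (rule measurable_compose) (intro borel_measurable_continuous_onI continuous_intros)

lemma borel_measurable_det:
  fixes A :: "'a \<Rightarrow> real^'n^'n"
  assumes [measurable]: "\<And>i j. (\<lambda>\<omega>. A \<omega> $ i $ j) \<in> borel_measurable M"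
  shows "(\<lambda>\<omega>. det (A \<omega>)) \<in> borel_measurable M"
  unfolding det_def by measurable

text \<open>\<open>matrix_inv\<close> is defined by choice and gives no direct access to
  measurability. Cramer's rule replaces \<open>matrix_inv S *v x\<close> by quotients of
  determinants, which are polynomials in the entries.\<close>

lemma borel_measurable_mvn_density_pair:
  fixes D :: "'w \<Rightarrow> real^'n^'n"
  assumes D: "D \<in> borel_measurable M" and pd: "\<And>\<omega>. \<omega> \<in> space M \<Longrightarrow> pos_def_mat (D \<omega>)"
  shows "(\<lambda>z. mvn_density (D (fst z)) (snd z)) \<in> borel_measurable (M \<Otimes>\<^sub>M borel)"
proof -
  have [measurable]: "(\<lambda>z. D (fst z) $ i $ j) \<in> borel_measurable (M \<Otimes>\<^sub>M borel)" for i j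
    by (intro borel_measurable_vec_nth_nth measurable_compose[OF measurable_fst D])
  have [measurable]: "(\<lambda>z. snd z $ i) \<in> borel_measurable (M \<Otimes>\<^sub>M borel)" for i :: 'n
    by (intro measurable_compose[OF measurable_snd] borel_measurable_continuous_onI continuous_intros)
  have [measurable]: "(\<lambda>z. det (D (fst z))) \<in> borel_measurable (M \<Otimes>\<^sub>M borel)"
    by (rule borel_measurable_det) measurable
  have [measurable]: "(\<lambda>z. det (\<chi> i j. if j = k then snd z $ i else D (fst z) $ i $ j)) \<in> borel_measurable (M \<Otimes>\<^sub>M borel)" for k
    by (rule borel_measurable_det) simp
  let ?f = "\<lambda>z. exp (- (\<Sum>k\<in>UNIV. snd z $ k * (det (\<chi> i j. if j = k then snd z $ i else D (fst z) $ i $ j) / det (D (fst z)))) / 2)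
      / sqrt ((2 * pi) ^ CARD('n) * det (D (fst z)))"
  have "?f \<in> borel_measurable (M \<Otimes>\<^sub>M borel)" by measurable
  moreover have "mvn_density (D (fst z)) (snd z) = ?f z" if "z \<in> space (M \<Otimes>\<^sub>M borel)" for z
  proof -
    let ?A = "D (fst z)" and ?x = "snd z"
    have A: "pos_def_mat ?A" using that by (intro pd) (auto simp: space_pair_measure)
    have "?A *v (matrix_inv ?A *v ?x) = ?x"
      by (simp add: matrix_vector_mul_assoc pos_def_mat_matrix_inv[OF A])
    then have "matrix_inv ?A *v ?x = (\<chi> k. det (\<chi> i j. if j = k then ?x $ i else ?A $ i $ j) / det ?A)"
      by (simp only: cramer[OF pos_def_mat_matrix_inv(3)[OF A]])
    then show ?thesis by (simp add: mvn_density_def inner_vec_def)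
  qed
  ultimately show ?thesis by (simp cong: measurable_cong)
qed

text \<open>The uncountably many inequalities of \<open>lambda_max_le_iff\<close> reduce, by
  continuity in \<open>x\<close>, to those with \<open>x\<close> in a countable dense set, and each
  of these is a measurable condition on the entries.\<close>

lemma borel_measurable_lambda_max:
  fixes D :: "'w \<Rightarrow> real^'n^'n"
  assumes D: "D \<in> borel_measurable M" and sym: "\<And>\<omega>. \<omega> \<in> space M \<Longrightarrow> transpose (D \<omega>) = D \<omega>"
  shows "(\<lambda>\<omega>. lambda_max (D \<omega>)) \<in> borel_measurable M"
proof (rule borel_measurable_iff_le[THEN iffD2], rule allI)
  fix c
  obtain E :: "(real^'n) set" where E: "countable E" "UNIV \<subseteq> closure E"
    by (rule separable)
  have [measurable]: "(\<lambda>\<omega>. D \<omega> $ i $ j) \<in> borel_measurable M" for i j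
    by (rule borel_measurable_vec_nth_nth[OF D])
  have meas: "(\<lambda>\<omega>. x \<bullet> (D \<omega> *v x)) \<in> borel_measurable M" for x
    unfolding inner_vec_def matrix_vector_mult_def by simp
  have dense: "(\<forall>x. x \<bullet> (A *v x) \<le> c * (x \<bullet> x)) \<longleftrightarrow> (\<forall>x\<in>E. x \<bullet> (A *v x) \<le> c * (x \<bullet> x))" for A
  proof
    assume *: "\<forall>x\<in>E. x \<bullet> (A *v x) \<le> c * (x \<bullet> x)"
    have "closed {x. x \<bullet> (A *v x) \<le> c * (x \<bullet> x)}"
      by (intro closed_Collect_le continuous_intros linear_continuous_on matrix_vector_mul_bounded_linear)
    then have "closure E \<subseteq> {x. x \<bullet> (A *v x) \<le> c * (x \<bullet> x)}"
      using * by (intro closure_minimal) auto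
    then show "\<forall>x. x \<bullet> (A *v x) \<le> c * (x \<bullet> x)" using E(2) by auto
  qed simp
  have "{\<omega> \<in> space M. lambda_max (D \<omega>) \<le> c} = {\<omega> \<in> space M. \<forall>x\<in>E. x \<bullet> (D \<omega> *v x) \<le> c * (x \<bullet> x)}"
    using lambda_max_le_iff[OF sym] by (simp add: dense cong: conj_cong)
  also have "\<dots> \<in> sets M"
    using E(1) meas by (intro sets.sets_Collect_countable_All' borel_measurable_le borel_measurable_const)
  finally show "{\<omega> \<in> space M. lambda_max (D \<omega>) \<le> c} \<in> sets M" .
qed

text \<open>By Fubini the law of a normal mixture has the averaged density.\<close>
lemma nn_integral_normal_mixture:
  fixes D :: "'w \<Rightarrow> real^'n^'n" and F :: "real^'n \<Rightarrow> ennreal"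
  assumes "prob_space P"
    and [measurable]: "\<xi> \<in> borel_measurable P" "F \<in> borel_measurable borel"
    and D: "D \<in> borel_measurable P" and pd: "\<And>\<omega>. \<omega> \<in> space P \<Longrightarrow> pos_def_mat (D \<omega>)"
    and law: "\<And>B. B \<in> sets borel \<Longrightarrow>
      emeasure P (\<xi> -` B \<inter> space P) = (\<integral>\<^sup>+\<omega>. emeasure (normal_vec (D \<omega>)) B \<partial>P)"
  shows "(\<integral>\<^sup>+\<omega>. F (\<xi> \<omega>) \<partial>P) = (\<integral>\<^sup>+\<omega>. (\<integral>\<^sup>+x. F x \<partial>normal_vec (D \<omega>)) \<partial>P)"
    and "(\<lambda>\<omega>. \<integral>\<^sup>+x. F x \<partial>normal_vec (D \<omega>)) \<in> borel_measurable P"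
proof -
  interpret prob_space P by fact
  interpret pair_sigma_finite P "lborel :: (real^'n) measure" ..
  note phi = borel_measurable_mvn_density_pair[OF D pd]
  have [measurable]: "(\<lambda>(\<omega>, x). ennreal (mvn_density (D \<omega>) x)) \<in> borel_measurable (P \<Otimes>\<^sub>M lborel)"
    using measurable_compose[OF phi measurable_ennreal] by (simp add: case_prod_beta' cong: measurable_cong_sets)
  have N: "(\<integral>\<^sup>+x. H x \<partial>normal_vec (D \<omega>)) = (\<integral>\<^sup>+x. ennreal (mvn_density (D \<omega>) x) * H x \<partial>lborel)"
    if "H \<in> borel_measurable borel" for H \<omega>
    using that unfolding normal_vec_def by (subst nn_integral_density) auto
  show "(\<lambda>\<omega>. \<integral>\<^sup>+x. F x \<partial>normal_vec (D \<omega>)) \<in> borel_measurable P"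
    by (simp add: N) measurable
  define f where "f x = (\<integral>\<^sup>+\<omega>. ennreal (mvn_density (D \<omega>) x) \<partial>P)" for x
  have [measurable]: "f \<in> borel_measurable borel"
    unfolding f_def
    using sigma_finite_measure.borel_measurable_nn_integral[OF prob_space_imp_sigma_finite[OF assms(1)], of "\<lambda>x \<omega>. ennreal (mvn_density (D \<omega>) x)" lborel]
      measurable_pair_swap[of "\<lambda>(\<omega>, x). ennreal (mvn_density (D \<omega>) x)"] by simp
  have swap: "(\<integral>\<^sup>+\<omega>. (\<integral>\<^sup>+x. ennreal (mvn_density (D \<omega>) x) * H x \<partial>lborel) \<partial>P) = (\<integral>\<^sup>+x. f x * H x \<partial>lborel)"
    if [measurable]: "H \<in> borel_measurable borel" for H
  proof -
    have "(\<integral>\<^sup>+\<omega>. (\<integral>\<^sup>+x. ennreal (mvn_density (D \<omega>) x) * H x \<partial>lborel) \<partial>P)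
      = (\<integral>\<^sup>+x. (\<integral>\<^sup>+\<omega>. ennreal (mvn_density (D \<omega>) x) * H x \<partial>P) \<partial>lborel)"
      by (rule Fubini'[symmetric]) measurable
    also have "\<dots> = (\<integral>\<^sup>+x. f x * H x \<partial>lborel)"
      unfolding f_def by (subst nn_integral_multc) simp_all
    finally show ?thesis .
  qed
  \<comment> \<open>The assumption \<open>law\<close> gives the mixture formula on sets only;
    identifying the distribution of \<open>\<xi>\<close> with a density extends it to all
    nonnegative measurable \<open>F\<close>.\<close>
  have "distr P borel \<xi> = density lborel f"
  proof (rule measure_eqI)
    fix B assume "B \<in> sets (distr P borel \<xi>)"
    then have [measurable]: "B \<in> sets borel" by simp
    have "emeasure (distr P borel \<xi>) B = (\<integral>\<^sup>+\<omega>. (\<integral>\<^sup>+x. indicator B x \<partial>normal_vec (D \<omega>)) \<partial>P)"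
      by (simp add: emeasure_distr law)
    also have "\<dots> = emeasure (density lborel f) B"
      by (simp only: N[of "indicator B"] swap[of "indicator B"] borel_measurable_indicator \<open>B \<in> sets borel\<close>)
         (simp add: emeasure_density)
    finally show "emeasure (distr P borel \<xi>) B = emeasure (density lborel f) B" .
  qed simp
  moreover have "(\<integral>\<^sup>+\<omega>. F (\<xi> \<omega>) \<partial>P) = (\<integral>\<^sup>+x. F x \<partial>distr P borel \<xi>)"
    by (simp add: nn_integral_distr)
  ultimately have "(\<integral>\<^sup>+\<omega>. F (\<xi> \<omega>) \<partial>P) = (\<integral>\<^sup>+x. F x \<partial>density lborel f)"
    by simp
  also have "\<dots> = (\<integral>\<^sup>+x. f x * F x \<partial>lborel)" by (simp add: nn_integral_density)
  also have "\<dots> = (\<integral>\<^sup>+\<omega>. (\<integral>\<^sup>+x. F x \<partial>normal_vec (D \<omega>)) \<partial>P)" by (simp add: N swap)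
  finally show "(\<integral>\<^sup>+\<omega>. F (\<xi> \<omega>) \<partial>P) = (\<integral>\<^sup>+\<omega>. (\<integral>\<^sup>+x. F x \<partial>normal_vec (D \<omega>)) \<partial>P)" .
qed

text \<open>Expanding the square gives equality as long as \<open>\<theta> + x\<close> is not 0. At
  0 the estimator is 0 and the loss is \<open>(norm x)\<^sup>2\<close>, while the right side keeps
  \<open>c\<^sup>2\<close>; hence only an inequality.\<close>

lemma james_stein_loss_le:
  fixes x \<theta> :: "'a::real_inner"
  shows "(norm ((1 - c / norm (\<theta> + x)) *\<^sub>R (\<theta> + x) - \<theta>))\<^sup>2
    \<le> (norm x)\<^sup>2 - 2 * c * ((x \<bullet> (\<theta> + x)) / norm (\<theta> + x)) + c\<^sup>2"
proof (cases "\<theta> + x = 0")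
  case True
  then have "x = - \<theta>" by (simp add: eq_neg_iff_add_eq_0 add.commute)
  then show ?thesis by simp
next
  case False
  define y where "y = \<theta> + x"
  have "(1 - c / norm y) *\<^sub>R y - \<theta> = x - (c / norm y) *\<^sub>R y"
    by (simp add: y_def algebra_simps)
  moreover have "(norm (x - b *\<^sub>R y))\<^sup>2 = x \<bullet> x - 2 * b * (x \<bullet> y) + b\<^sup>2 * (y \<bullet> y)" for b
    unfolding power2_norm_eq_inner
    by (simp add: inner_diff inner_commute[of y x] power2_eq_square algebra_simps)
  ultimately have "(norm ((1 - c / norm y) *\<^sub>R y - \<theta>))\<^sup>2
      = x \<bullet> x - 2 * (c / norm y) * (x \<bullet> y) + (c / norm y)\<^sup>2 * (y \<bullet> y)"
    by (simp only:)
  also have "(c / norm y)\<^sup>2 * (y \<bullet> y) = c\<^sup>2"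
    using False by (simp add: y_def power_divide dot_square_norm)
  finally show ?thesis by (simp add: y_def power2_norm_eq_inner)
qed

text \<open>The supremum over the parameter set is rendered as a bound at each of its points;
  \<open>cond_gauss\<close> is the defining property of a conditional law, tested on the sets of
  \<open>G\<close>.\<close>

theorem theorem2p1:
  fixes \<Theta> :: "(real^'p) set"
    and \<Omega> :: "'w measure" and G :: "'w measure"
    and P :: "real^'p \<Rightarrow> 'w measure"
    and \<xi> :: "'w \<Rightarrow> real^'p"
    and D :: "'w \<Rightarrow> real^'p^'p"
    and lam astar :: real
  assumes p2: "CARD('p) \<ge> 2"
    and cpt: "compact \<Theta>"
    and dpos: "(SUP \<theta>\<in>\<Theta>. norm \<theta>) > 0"
    and Pprob: "\<And>\<theta>. \<theta> \<in> \<Theta> \<Longrightarrow> prob_space (P \<theta>)"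
    and Psets: "\<And>\<theta>. \<theta> \<in> \<Theta> \<Longrightarrow> sets (P \<theta>) = sets \<Omega>"
    and Gsub: "subalgebra \<Omega> G"
    and \<xi>meas: "\<xi> \<in> borel_measurable \<Omega>"
    and Dmeas: "D \<in> borel_measurable G"
    and Dpd: "\<And>\<omega>. \<omega> \<in> space \<Omega> \<Longrightarrow> pos_def_mat (D \<omega>)"
    and cond_gauss: "\<And>\<theta> A B. \<theta> \<in> \<Theta> \<Longrightarrow> A \<in> sets G \<Longrightarrow> B \<in> sets borel \<Longrightarrow>
        emeasure (P \<theta>) (A \<inter> \<xi> -` B \<inter> space \<Omega>)
          = (\<integral>\<^sup>+\<omega>\<in>A. emeasure (normal_vec (D \<omega>)) B \<partial>P \<theta>)"
    and lam_pos: "lam > 0"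
    and hyp_i: "\<And>\<theta>. \<theta> \<in> \<Theta> \<Longrightarrow> AE \<omega> in P \<theta>. lambda_min (D \<omega>) \<ge> lam"
    and astar_pos: "astar > 0"
    and hyp_ii: "\<And>\<theta>. \<theta> \<in> \<Theta> \<Longrightarrow> (\<integral>\<^sup>+\<omega>. ennreal (lambda_max (D \<omega>)) \<partial>P \<theta>) \<le> ennreal astar"
  shows "\<forall>\<theta>\<in>\<Theta>.
     (let Y = (\<lambda>\<omega>. \<theta> + \<xi> \<omega>);
          c = (real CARD('p) - 1) * lam * gamma_const CARD('p) (SUP \<theta>\<in>\<Theta>. norm \<theta>) astar;
          \<theta>star = (\<lambda>\<omega>. (1 - c / norm (Y \<omega>)) *\<^sub>R Y \<omega>)
      in (\<integral>\<omega>. (norm (\<theta>star \<omega> - \<theta>))\<^sup>2 \<partial>P \<theta>) - (\<integral>\<omega>. (norm (Y \<omega> - \<theta>))\<^sup>2 \<partial>P \<theta>) \<le> - c\<^sup>2)"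
proof (intro ballI)
  fix \<theta> assume \<theta>: "\<theta> \<in> \<Theta>"
  define d where "d = (SUP \<theta>\<in>\<Theta>. norm \<theta>)"
  define h where "h x = (x \<bullet> (\<theta> + x)) / norm (\<theta> + x)" for x
  \<comment> \<open>The factor \<open>(p - 1) * lam\<close> is included here, unlike in the constant
    of the same name in \<open>normal_vec_shrinkage_bound\<close>.\<close>
  define \<kappa> where "\<kappa> = (real CARD('p) - 1) * lam * (\<integral>y. tangent_slope d astar (norm y) \<partial>normal_vec (mat 1 :: real^'p^'p))"
  define c where "c = (real CARD('p) - 1) * lam * gamma_const CARD('p) d astar"
  have d: "d > 0" using dpos by (simp add: d_def)
  have "bdd_above (norm ` \<Theta>)"
    using compact_imp_bounded[OF cpt] by (simp add: bounded_imp_bdd_above bounded_norm_comp)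
  then have nd: "norm \<theta> \<le> d" unfolding d_def using \<theta> by (rule cSUP_upper[rotated])
  interpret prob_space "P \<theta>" by (rule Pprob[OF \<theta>])
  have spP: "space (P \<theta>) = space \<Omega>" by (rule sets_eq_imp_space_eq[OF Psets[OF \<theta>]])
  have [measurable]: "\<xi> \<in> borel_measurable (P \<theta>)"
    using \<xi>meas measurable_cong_sets[OF Psets[OF \<theta>] refl] by blast
  have D: "D \<in> borel_measurable (P \<theta>)"
    using measurable_from_subalg[OF Gsub Dmeas] measurable_cong_sets[OF Psets[OF \<theta>] refl] by blast
  have pd: "pos_def_mat (D \<omega>)" if "\<omega> \<in> space (P \<theta>)" for \<omega>
    using that Dpd by (simp add: spP)
  have law: "emeasure (P \<theta>) (\<xi> -` B \<inter> space (P \<theta>)) = (\<integral>\<^sup>+\<omega>. emeasure (normal_vec (D \<omega>)) B \<partial>P \<theta>)"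
    if "B \<in> sets borel" for B
  proof -
    have spG: "space G = space \<Omega>" using Gsub by (simp add: subalgebra_def)
    have "space G \<inter> \<xi> -` B \<inter> space \<Omega> = \<xi> -` B \<inter> space (P \<theta>)" by (auto simp: spG spP)
    then have "emeasure (P \<theta>) (\<xi> -` B \<inter> space (P \<theta>))
        = (\<integral>\<^sup>+\<omega>\<in>space G. emeasure (normal_vec (D \<omega>)) B \<partial>P \<theta>)"
      using cond_gauss[OF \<theta> sets.top that] by simp
    also have "\<dots> = (\<integral>\<^sup>+\<omega>. emeasure (normal_vec (D \<omega>)) B \<partial>P \<theta>)"
      by (intro nn_integral_cong) (simp add: spG spP)
    finally show ?thesis .
  qed
  have mix: "(\<integral>\<^sup>+\<omega>. F (\<xi> \<omega>) \<partial>P \<theta>) = (\<integral>\<^sup>+\<omega>. (\<integral>\<^sup>+x. F x \<partial>normal_vec (D \<omega>)) \<partial>P \<theta>)"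
      "(\<lambda>\<omega>. \<integral>\<^sup>+x. F x \<partial>normal_vec (D \<omega>)) \<in> borel_measurable (P \<theta>)"
    if "F \<in> borel_measurable borel" for F
    using nn_integral_normal_mixture[OF Pprob[OF \<theta>] \<open>\<xi> \<in> borel_measurable (P \<theta>)\<close> that D] pd law
    by blast+
  have [measurable]: "(\<lambda>\<omega>. lambda_max (D \<omega>)) \<in> borel_measurable (P \<theta>)"
    using pd by (intro borel_measurable_lambda_max D) (simp add: pos_def_mat_def)
  have [measurable]: "h \<in> borel_measurable borel" unfolding h_def by measurable
  have hn: "\<bar>h x\<bar> \<le> norm x" for x
  proof (cases "\<theta> + x = 0")
    case False
    then show ?thesis using Cauchy_Schwarz_ineq2[of x "\<theta> + x"] by (simp add: h_def pos_divide_le_eq)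
  qed (simp add: h_def)
  have int_sq: "integrable (P \<theta>) (\<lambda>\<omega>. (norm (\<xi> \<omega>))\<^sup>2)"
  proof (rule integrableI_nonneg)
    define m where "m = (\<integral>\<^sup>+y. ennreal ((norm y)\<^sup>2) \<partial>normal_vec (mat 1 :: real^'p^'p))"
    have "(\<integral>\<^sup>+\<omega>. ennreal ((norm (\<xi> \<omega>))\<^sup>2) \<partial>P \<theta>)
        = (\<integral>\<^sup>+\<omega>. (\<integral>\<^sup>+x. ennreal ((norm x)\<^sup>2) \<partial>normal_vec (D \<omega>)) \<partial>P \<theta>)"
      by (rule mix(1)) measurable
    also have "\<dots> \<le> (\<integral>\<^sup>+\<omega>. ennreal (lambda_max (D \<omega>)) * m \<partial>P \<theta>)"
      unfolding m_def by (intro nn_integral_mono nn_integral_normal_vec_norm_sq_le pd)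
    also have "\<dots> = (\<integral>\<^sup>+\<omega>. ennreal (lambda_max (D \<omega>)) \<partial>P \<theta>) * m"
      by (intro nn_integral_multc) measurable
    also have "\<dots> \<le> ennreal astar * m" by (intro mult_right_mono hyp_ii[OF \<theta>]) simp
    also have "\<dots> < \<infinity>"
      using nn_integral_std_normal_norm_sq[where 'n='p] by (simp add: m_def ennreal_mult_less_top)
    finally show "(\<integral>\<^sup>+\<omega>. ennreal ((norm (\<xi> \<omega>))\<^sup>2) \<partial>P \<theta>) < \<infinity>" .
  qed simp_all
  have int_n: "integrable (P \<theta>) (\<lambda>\<omega>. norm (\<xi> \<omega>))"
    by (rule square_integrable_imp_integrable[OF _ int_sq]) measurable
  have int_h: "integrable (P \<theta>) (\<lambda>\<omega>. h (\<xi> \<omega>))"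
    by (rule Bochner_Integration.integrable_bound[OF int_n]) (use hn in auto)
  have gamma_nonneg: "gamma_const CARD('p) d astar \<ge> 0"
    unfolding gamma_const_eq_integral[OF p2 d astar_pos]
    using d astar_pos by (intro Bochner_Integration.integral_nonneg) simp
  have c: "c \<ge> 0" using p2 lam_pos gamma_nonneg by (simp add: c_def)
  have \<kappa>: "\<kappa> \<ge> 0"
    using p2 lam_pos tangent_slope_bounds(1)[OF d astar_pos] by (simp add: \<kappa>_def Bochner_Integration.integral_nonneg)
  have cEh: "c \<le> (\<integral>\<omega>. h (\<xi> \<omega>) \<partial>P \<theta>)"
  proof -
    \<comment> \<open>Written without subtraction, for use in \<open>ennreal\<close>:
      \<open>norm x\<close> is added on both sides because \<open>h x + norm x \<ge> 0\<close>, and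
      \<open>\<kappa> * astar\<close> has moved to the left.\<close>
    have N: "ennreal (c + \<kappa> * astar) + (\<integral>\<^sup>+x. ennreal (norm x) \<partial>normal_vec (D \<omega>))
        \<le> (\<integral>\<^sup>+x. ennreal (h x + norm x) \<partial>normal_vec (D \<omega>)) + ennreal \<kappa> * ennreal (lambda_max (D \<omega>))"
      if \<omega>: "\<omega> \<in> space (P \<theta>)" "lam \<le> lambda_min (D \<omega>)" for \<omega>
    proof -
      let ?N = "normal_vec (D \<omega>)"
      note S = pd[OF \<omega>(1)]
      have i1: "integrable ?N norm" by (rule integrable_normal_vec_norm[OF S])
      have i2: "integrable ?N h"
        by (rule Bochner_Integration.integrable_bound[OF i1]) (use hn in auto)
      have e1: "(\<integral>\<^sup>+x. ennreal (norm x) \<partial>?N) = ennreal (\<integral>x. norm x \<partial>?N)"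
        by (rule nn_integral_eq_integral[OF i1]) simp
      have "(\<integral>\<^sup>+x. ennreal (h x + norm x) \<partial>?N) = ennreal (\<integral>x. h x + norm x \<partial>?N)"
        using hn by (intro nn_integral_eq_integral Bochner_Integration.integrable_add i1 i2 AE_I2)
          (metis abs_ge_minus_self add.commute diff_ge_0_iff_ge diff_minus_eq_add order_trans)
      then have e2: "(\<integral>\<^sup>+x. ennreal (h x + norm x) \<partial>?N) = ennreal ((\<integral>x. h x \<partial>?N) + (\<integral>x. norm x \<partial>?N))"
        by (simp add: Bochner_Integration.integral_add[OF i2 i1])
      have L: "lambda_max (D \<omega>) \<ge> 0" using lambda_max_pos[OF S] by simp
      have "c \<le> (\<integral>x. h x \<partial>?N) + \<kappa> * (lambda_max (D \<omega>) - astar)"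
        using normal_vec_shrinkage_bound[OF p2 S _ \<omega>(2) nd d astar_pos] lam_pos
        by (simp add: c_def \<kappa>_def h_def)
      then have "c + \<kappa> * astar + (\<integral>x. norm x \<partial>?N)
          \<le> ((\<integral>x. h x \<partial>?N) + (\<integral>x. norm x \<partial>?N)) + \<kappa> * lambda_max (D \<omega>)"
        by (simp add: algebra_simps)
      moreover have "0 \<le> (\<integral>x. h x + norm x \<partial>?N)"
        using hn by (intro Bochner_Integration.integral_nonneg) (metis abs_ge_minus_self add.commute diff_ge_0_iff_ge diff_minus_eq_add order_trans)
      then have "0 \<le> (\<integral>x. h x \<partial>?N) + (\<integral>x. norm x \<partial>?N)"
        by (simp add: Bochner_Integration.integral_add[OF i2 i1])
      ultimately show ?thesis
        unfolding e1 e2 using c \<kappa> astar_pos L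
        by (simp add: ennreal_plus[symmetric] ennreal_mult[symmetric] ennreal_leI del: ennreal_plus)
    qed
    have [measurable]: "(\<lambda>\<omega>. \<integral>\<^sup>+x. ennreal (norm x) \<partial>normal_vec (D \<omega>)) \<in> borel_measurable (P \<theta>)"
      "(\<lambda>\<omega>. \<integral>\<^sup>+x. ennreal (h x + norm x) \<partial>normal_vec (D \<omega>)) \<in> borel_measurable (P \<theta>)"
      by (rule mix(2); measurable)+
    have "ennreal (c + \<kappa> * astar) + (\<integral>\<^sup>+\<omega>. ennreal (norm (\<xi> \<omega>)) \<partial>P \<theta>)
        = (\<integral>\<^sup>+\<omega>. ennreal (c + \<kappa> * astar) + (\<integral>\<^sup>+x. ennreal (norm x) \<partial>normal_vec (D \<omega>)) \<partial>P \<theta>)"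
      by (simp add: nn_integral_add emeasure_space_1 mix(1)[of "\<lambda>x. ennreal (norm x)"])
    also have "\<dots> \<le> (\<integral>\<^sup>+\<omega>. (\<integral>\<^sup>+x. ennreal (h x + norm x) \<partial>normal_vec (D \<omega>))
        + ennreal \<kappa> * ennreal (lambda_max (D \<omega>)) \<partial>P \<theta>)"
      using hyp_i[OF \<theta>] N by (intro nn_integral_mono_AE) (auto elim!: AE_mp)
    also have "\<dots> = (\<integral>\<^sup>+\<omega>. ennreal (h (\<xi> \<omega>) + norm (\<xi> \<omega>)) \<partial>P \<theta>)
        + ennreal \<kappa> * (\<integral>\<^sup>+\<omega>. ennreal (lambda_max (D \<omega>)) \<partial>P \<theta>)"
      by (simp add: nn_integral_add nn_integral_cmult mix(1)[of "\<lambda>x. ennreal (h x + norm x)"])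
    \<comment> \<open>Here the mean of \<open>lambda_max\<close> is bounded by \<open>astar\<close>;
      the two terms \<open>\<kappa> * astar\<close> cancel at the end.\<close>
    also have "\<dots> \<le> (\<integral>\<^sup>+\<omega>. ennreal (h (\<xi> \<omega>) + norm (\<xi> \<omega>)) \<partial>P \<theta>) + ennreal \<kappa> * ennreal astar"
      by (intro add_left_mono mult_left_mono hyp_ii[OF \<theta>]) simp
    finally have "ennreal (c + \<kappa> * astar) + (\<integral>\<^sup>+\<omega>. ennreal (norm (\<xi> \<omega>)) \<partial>P \<theta>)
        \<le> (\<integral>\<^sup>+\<omega>. ennreal (h (\<xi> \<omega>) + norm (\<xi> \<omega>)) \<partial>P \<theta>) + ennreal \<kappa> * ennreal astar" .
    moreover have "(\<integral>\<^sup>+\<omega>. ennreal (norm (\<xi> \<omega>)) \<partial>P \<theta>) = ennreal (\<integral>\<omega>. norm (\<xi> \<omega>) \<partial>P \<theta>)"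
      by (rule nn_integral_eq_integral[OF int_n]) simp
    moreover have hpos: "0 \<le> h x + norm x" for x using hn[of x] by linarith
    then have "(\<integral>\<^sup>+\<omega>. ennreal (h (\<xi> \<omega>) + norm (\<xi> \<omega>)) \<partial>P \<theta>) = ennreal (\<integral>\<omega>. h (\<xi> \<omega>) + norm (\<xi> \<omega>) \<partial>P \<theta>)"
      by (intro nn_integral_eq_integral Bochner_Integration.integrable_add int_h int_n) simp
    moreover have "0 \<le> (\<integral>\<omega>. h (\<xi> \<omega>) + norm (\<xi> \<omega>) \<partial>P \<theta>)" using hpos by (intro Bochner_Integration.integral_nonneg) simp
    ultimately have "c + \<kappa> * astar + (\<integral>\<omega>. norm (\<xi> \<omega>) \<partial>P \<theta>)
        \<le> (\<integral>\<omega>. h (\<xi> \<omega>) + norm (\<xi> \<omega>) \<partial>P \<theta>) + \<kappa> * astar"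
      using c \<kappa> astar_pos
      by (simp add: ennreal_plus[symmetric] ennreal_mult[symmetric] ennreal_le_iff Bochner_Integration.integral_nonneg del: ennreal_plus)
    then show ?thesis by (simp add: Bochner_Integration.integral_add[OF int_h int_n])
  qed
  let ?g = "\<lambda>\<omega>. (norm (\<xi> \<omega>))\<^sup>2 - 2 * c * h (\<xi> \<omega>) + c\<^sup>2"
  have int_g: "integrable (P \<theta>) ?g" using int_sq int_h by simp
  have "(\<integral>\<omega>. (norm ((1 - c / norm (\<theta> + \<xi> \<omega>)) *\<^sub>R (\<theta> + \<xi> \<omega>) - \<theta>))\<^sup>2 \<partial>P \<theta>) \<le> (\<integral>\<omega>. ?g \<omega> \<partial>P \<theta>)"
  \<comment> \<open>\<open>integral_mono'\<close> asks for integrability of the majorant only,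
    together with its nonnegativity.\<close>
  proof (rule integral_mono'[OF int_g])
    show le: "(norm ((1 - c / norm (\<theta> + \<xi> \<omega>)) *\<^sub>R (\<theta> + \<xi> \<omega>) - \<theta>))\<^sup>2 \<le> ?g \<omega>" for \<omega>
      unfolding h_def by (rule james_stein_loss_le)
    show "0 \<le> ?g \<omega>" for \<omega> using order_trans[OF zero_le_power2 le] .
  qed
  also have "\<dots> = (\<integral>\<omega>. (norm (\<xi> \<omega>))\<^sup>2 \<partial>P \<theta>) - 2 * c * (\<integral>\<omega>. h (\<xi> \<omega>) \<partial>P \<theta>) + c\<^sup>2"
    using int_sq int_h by (simp add: prob_space)
  \<comment> \<open>From \<open>c * c \<le> c * E (h \<xi>)\<close>: the linear term is worth at
    least \<open>2 * c\<^sup>2\<close>, twice the quadratic one.\<close>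
  also have "\<dots> \<le> (\<integral>\<omega>. (norm (\<xi> \<omega>))\<^sup>2 \<partial>P \<theta>) - c\<^sup>2"
    using mult_left_mono[OF cEh c] by (simp add: power2_eq_square)
  finally show "(let Y = (\<lambda>\<omega>. \<theta> + \<xi> \<omega>);
          c = (real CARD('p) - 1) * lam * gamma_const CARD('p) (SUP \<theta>\<in>\<Theta>. norm \<theta>) astar;
          \<theta>star = (\<lambda>\<omega>. (1 - c / norm (Y \<omega>)) *\<^sub>R Y \<omega>)
      in (\<integral>\<omega>. (norm (\<theta>star \<omega> - \<theta>))\<^sup>2 \<partial>P \<theta>) - (\<integral>\<omega>. (norm (Y \<omega> - \<theta>))\<^sup>2 \<partial>P \<theta>) \<le> - c\<^sup>2)"
    unfolding Let_def d_def[symmetric] c_def[symmetric] by simp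
qed

end
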